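(* For $r\in\mathbb{Z}_{\ge0}$ we have $C(t^{r+1},0)=1$, and for $i\in\mathbb{Z}_{>0}$, $r\in\mathbb{Z}_{\ge0}$ we have $$C\big(t^{r+1},i\big)=\sum_{(d_1,\ldots,d_i)\in\mathcal{P}[r,i]}F\big(t^{r+1},d_1\big)F\big(t^{r+1},d_2\big)\cdots F\big(t^{r+1},d_i\big),$$ where $\mathcal{P}[r,i]$ is the finite set $$\mathcal{P}[r,i]=\big\{(d_1,d_2,\ldots,d_i)\in\mathbb{Z}^i\ \big|\ 0\le d_1\le r,\ d_k-1\le d_{k+1}\le r\ \text{for}\ 1\le k<i\big\}.$$
   Context: $a,c,t$ are generic complex parameters (or indeterminates). Notation: $(z;q)_k=\prod_{j=0}^{k-1}(1-q^jz)$, $(a_1,\dots,a_r;q)_k=\prod_i(a_i;q)_k$, ${}_4\phi_3\left[{a_1,a_2,a_3,a_4\atop b_1,b_2,b_3};q,z\right]=\sum_{k\ge0}\frac{(a_1,a_2,a_3,a_4;q)_k}{(q,b_1,b_2,b_3;q)_k}z^k$ (terminating here). For $j\ge0$ define the rational function of $s$ $$B(s,j)=(-1)^js^{-j}\frac{(s^2/t^2;t^2)_j}{(t^2;t^2)_j}\frac{1-s^2t^{4j-2}}{1-s^2t^{-2}}\,{}_4\phi_3\left[{-sa^2,-sc^2,s^2t^{2j-2},t^{-2j}\atop -s,-st,s^2a^2c^2/t};t^2,t^2\right].$$ For $s=t^{m+1}$, $m\in\mathbb{C}$, define $$C(s,j)=\sum_{i=0}^jB(s,i)\binom{m+2j}{j-i},\qquad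 \binom{m}{j}=\frac{m(m-1)\cdots(m-j+1)}{j!}.$$ (So $C(t^{r+1},j)$ uses $m=r$.) Finally $$F(s,l)=\frac{\big(1-t^l/s\big)\big(1-t^{l+2}/(sa^2c^2)\big)\big(1+t^{l+1}/(sa^2)\big)\big(1+t^{l+1}/(sc^2)\big)}{\big(1-t^{2l+1}/(s^2a^2c^2)\big)\big(1-t^{2l+3}/(s^2a^2c^2)\big)}.$$ Rational functions of $s$ are evaluated after cancelling common factors. *)

theory Defs
  imports
    Complex_Main
    "HOL-Library.Groups_Big_Fun"
    "HOL-Computational_Algebra.Polynomial_Factorial"
    "HOL-Computational_Algebra.Field_as_Ring"
begin

definition qpoch :: "'k::field \<Rightarrow> 'k \<Rightarrow> nat \<Rightarrow> 'k" where
  "qpoch z q k = (\<Prod>j<k. 1 - q ^ j * z)"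

definition qpochs :: "'k::field list \<Rightarrow> 'k \<Rightarrow> nat \<Rightarrow> 'k" where
  "qpochs as q k = (\<Prod>a\<leftarrow>as. qpoch a q k)"

text \<open>
  The series over all \<open>k \<ge> 0\<close>, meaningful only when it terminates: \<^const>\<open>Sum_any\<close> adds up
  the finitely many non-zero terms, and is 0 if there are infinitely many of them.
\<close>

definition phi43 :: "'k::field \<Rightarrow> 'k \<Rightarrow> 'k \<Rightarrow> 'k \<Rightarrow> 'k \<Rightarrow> 'k \<Rightarrow> 'k \<Rightarrow> 'k \<Rightarrow> 'k \<Rightarrow> 'k" where
  "phi43 a1 a2 a3 a4 b1 b2 b3 q z =
     Sum_any (\<lambda>k::nat. qpochs [a1, a2, a3, a4] q k / qpochs [q, b1, b2, b3] q k * z ^ k)"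

text \<open>
  The expressions for \<open>B\<close> and \<open>F\<close> are written over an arbitrary field. They are used in the field
  of rational functions of \<open>s\<close>, taking the indeterminate for \<open>s\<close> and constants for \<open>a, c, t\<close>.
\<close>

definition B_expr :: "'k::field \<Rightarrow> 'k \<Rightarrow> 'k \<Rightarrow> 'k \<Rightarrow> nat \<Rightarrow> 'k" where
  "B_expr a c t s j =
     (-1) ^ j * s powi (- int j)
     * (qpoch (s^2 / t^2) (t^2) j / qpoch (t^2) (t^2) j)
     * ((1 - s^2 * t powi (4 * int j - 2)) / (1 - s^2 * t powi (-2)))
     * phi43 (- s * a^2) (- s * c^2) (s^2 * t powi (2 * int j - 2)) (t powi (-2 * int j))
             (- s) (- s * t) (s^2 * a^2 * c^2 / t) (t^2) (t^2)"

definition F_expr :: "'k::field \<Rightarrow> 'k \<Rightarrow> 'k \<Rightarrow> 'k \<Rightarrow> int \<Rightarrow> 'k" where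
  "F_expr a c t s l =
     ((1 - t powi l / s) * (1 - t powi (l + 2) / (s * a^2 * c^2))
       * (1 + t powi (l + 1) / (s * a^2)) * (1 + t powi (l + 1) / (s * c^2)))
     / ((1 - t powi (2 * l + 1) / (s^2 * a^2 * c^2))
       * (1 - t powi (2 * l + 3) / (s^2 * a^2 * c^2)))"

type_synonym ratfun = "complex poly fract"

definition const_rf :: "complex \<Rightarrow> ratfun" where
  "const_rf z = to_fract [:z:]"

definition var_rf :: ratfun where
  "var_rf = to_fract [:0, 1:]"

text \<open>
  Evaluation after cancelling common factors: \<^const>\<open>quot_of_fract\<close> returns numerator and
  denominator in lowest terms.
\<close>

definition eval_rf :: "ratfun \<Rightarrow> complex \<Rightarrow> complex" where
  "eval_rf f x = poly (fst (quot_of_fract f)) x / poly (snd (quot_of_fract f)) x"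

lemma eval_rf_divide:
  assumes "poly q x \<noteq> 0"
  shows "eval_rf (to_fract p / to_fract q) x = poly p x / poly q x"
proof -
  have q0: "q \<noteq> 0" using assms by auto
  have "to_fract p / to_fract q = quot_to_fract (p, q)"
    using q0 by (simp add: to_fract_def quot_to_fract_def)
  hence *: "quot_of_fract (to_fract p / to_fract q) = normalize_quot (p, q)"
    by (simp add: quot_of_fract_quot_to_fract)
  from normalize_quotE[OF q0, of p] obtain d where
    d: "p = fst (normalize_quot (p, q)) * d" "q = snd (normalize_quot (p, q)) * d" "d \<noteq> 0" by metis
  have p': "poly p x = poly (fst (normalize_quot (p, q))) x * poly d x"
    by (subst (1) d(1)) simp
  have q': "poly q x = poly (snd (normalize_quot (p, q))) x * poly d x"
    by (subst (1) d(2)) simp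
  show ?thesis using assms unfolding eval_rf_def * p' q' by auto
qed

definition B_coeff :: "complex \<Rightarrow> complex \<Rightarrow> complex \<Rightarrow> nat \<Rightarrow> ratfun" where
  "B_coeff a c t j = B_expr (const_rf a) (const_rf c) (const_rf t) var_rf j"

definition F_coeff :: "complex \<Rightarrow> complex \<Rightarrow> complex \<Rightarrow> int \<Rightarrow> ratfun" where
  "F_coeff a c t l = F_expr (const_rf a) (const_rf c) (const_rf t) var_rf l"

text \<open>
  \<open>C(s,j)\<close> for \<open>s = t\<^sup>m\<^sup>+\<^sup>1\<close>. Both \<open>s\<close> and \<open>m\<close> are arguments, since \<open>m\<close> is not determined
  by \<open>s\<close>, and for complex \<open>m\<close> the value of \<open>s\<close> depends on a branch of \<open>log t\<close>.
\<close>

definition C_coeff :: "complex \<Rightarrow> complex \<Rightarrow> complex \<Rightarrow> complex \<Rightarrow> complex \<Rightarrow> nat \<Rightarrow> complex" where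
  "C_coeff a c t s m j =
     (\<Sum>i\<le>j. eval_rf (B_coeff a c t i) s * ((m + 2 * of_nat j) gchoose (j - i)))"

text \<open>Tuples are 0-indexed lists: \<open>d\<^sub>k\<close> is \<open>d ! (k - 1)\<close>.\<close>

definition path_set :: "nat \<Rightarrow> nat \<Rightarrow> int list set" where
  "path_set r i =
     {d. length d = i \<and> 0 \<le> d ! 0 \<and> d ! 0 \<le> int r \<and>
         (\<forall>k. Suc k < i \<longrightarrow> d ! k - 1 \<le> d ! Suc k \<and> d ! Suc k \<le> int r)}"

lemma finite_path_set:
  assumes "i > 0"
  shows "finite (path_set r i)"
proof (rule finite_subset)
  show "path_set r i \<subseteq> {d. set d \<subseteq> {- int i..int r} \<and> length d = i}"
  proof
    fix d assume d: "d \<in> path_set r i"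
    have "k < i \<longrightarrow> - int k \<le> d ! k \<and> d ! k \<le> int r" for k
    proof (induction k)
      case 0
      then show ?case using d by (simp add: path_set_def)
    next
      case (Suc k)
      show ?case
      proof
        assume k: "Suc k < i"
        hence "d ! k - 1 \<le> d ! Suc k \<and> d ! Suc k \<le> int r"
          using d by (simp add: path_set_def)
        thus "- int (Suc k) \<le> d ! Suc k \<and> d ! Suc k \<le> int r" using Suc k by simp
      qed
    qed
    hence "- int i \<le> d ! k \<and> d ! k \<le> int r" if "k < i" for k
      using that by (smt (verit) of_nat_less_iff)
    thus "d \<in> {d. set d \<subseteq> {- int i..int r} \<and> length d = i}"
      using d by (auto simp: path_set_def in_set_conv_nth)
  qed
  show "finite {d. set d \<subseteq> {- int i..int r} \<and> length d = i}"
    by (rule finite_lists_length_eq) simp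
qed

text \<open>
  What genericity of \<open>a, c, t\<close> amounts to here: at \<open>s = t\<^sup>r\<^sup>+\<^sup>1\<close> no denominator other than the
  cancelling factor \<open>1 - s\<^sup>2t\<^sup>-\<^sup>2\<close> vanishes. The factors of \<open>(-s,-st;t\<^sup>2)\<^sub>k\<close> are of the form
  \<open>1 + t\<^sup>n\<close> with \<open>n > 0\<close>, hence covered by \<open>t\<close> not being a root of unity; the denominators
  of \<open>F\<close> and the factors of \<open>(s\<^sup>2a\<^sup>2c\<^sup>2/t;t\<^sup>2)\<^sub>k\<close> involve odd powers of \<open>t\<close> only.
\<close>

definition generic_params :: "complex \<Rightarrow> complex \<Rightarrow> complex \<Rightarrow> bool" where
  "generic_params a c t \<longleftrightarrow>
     a \<noteq> 0 \<and> c \<noteq> 0 \<and> t \<noteq> 0 \<and> (\<forall>n::nat. n > 0 \<longrightarrow> t ^ n \<noteq> 1) \<and>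
     (\<forall>n::int. odd n \<longrightarrow> a^2 * c^2 \<noteq> t powi n)"

end

theory Submission
  imports Defs
begin

text \<open>
  \<open>F(s,l)\<close> depends on \<open>s t\<^sup>-\<^sup>l\<close> only; write \<open>f(s) = F(s,0)\<close>. Splitting off the first entry of a path shows
  that the path sum \<open>W(r,i)\<close> satisfies \<open>W(r,i) - W(r-1,i) = f(t\<^sup>r\<^sup>+\<^sup>1) W(r+1,i-1)\<close>. By Pascal's rule,
  \<open>C(t\<^sup>r\<^sup>+\<^sup>1,i)\<close> satisfies the same recurrence if
  \<open>B(s,i) + B(s,i-1) = B(s/t,i) + f(s) B(st,i-1)\<close>, and \<open>C(1,i) = 0\<close> for \<open>i > 0\<close>, \<open>m = -1\<close> because
  \<open>B(1,0) = 1\<close>, \<open>B(1,1) = -1\<close> and \<open>B(1,j) = 0\<close> otherwise.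

  The shift of \<open>s\<close> by \<open>t\<close> is not compatible with the base \<open>t\<^sup>2\<close> of the parameters \<open>-sa\<^sup>2\<close>, \<open>-sc\<^sup>2\<close> of the
  series. Sears' transformation of balanced terminating series replaces them by \<open>1/a\<^sup>2\<close>, \<open>1/c\<^sup>2\<close>, after which the
  recurrence for \<open>B\<close> holds coefficientwise with respect to the products
  \<open>(1/a\<^sup>2, 1/c\<^sup>2; t\<^sup>2)\<^sub>k\<close>. Sears' transformation itself follows from two applications of the
  q-Saalschuetz sum.
\<close>

section \<open>The q-Saalschuetz sum\<close>

text \<open>Write x = a^2, y = c^2, q = t^2. The series in B(s,j) is balanced: the product
  (-s)(-st)(s^2xy/t) of its lower parameters is q times the product of its upper ones, which is what
  admits Sears' transformation. The upper pair -sx, -sy is matched with the lower parameter -s,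
  because (-s)/(-sx) = 1/x and (-s)/(-sy) = 1/y no longer contain s, while (-sx)(-sy)/(-s) = -sxy
  involves x and y only through xy. The shift of s then does not touch the products that contain x
  and y separately, and the factor (1 + t/(sx))(1 + t/(sy)) of f(s) is absorbed by passing between
  consecutive products. The recurrence is proved for field elements s, not for an indeterminate.
  Poles therefore have to be excluded at s, st and s/t together, and two values need care: s = 1,
  where the recurrence starts, and s = t (that is, r = 0), where the factor 1 - s^2/t^2 must be
  cancelled before evaluating.\<close>

lemma qpoch_0 [simp]: "qpoch z q 0 = 1"
  by (simp add: qpoch_def)

lemma qpoch_Suc: "qpoch z q (Suc k) = qpoch z q k * (1 - q ^ k * z)"
  by (simp add: qpoch_def)

lemma qpoch_Suc_left: "qpoch z q (Suc k) = (1 - z) * qpoch (q * z) q k"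
  by (induction k) (simp_all add: qpoch_Suc mult_ac)

lemma qpoch_add: "qpoch z q (m + n) = qpoch z q m * qpoch (q ^ m * z) q n"
  by (induction n) (simp_all add: qpoch_Suc power_add mult_ac)

lemma qpoch_eq_0_iff: "qpoch z q n = 0 \<longleftrightarrow> (\<exists>j<n. q ^ j * z = 1)"
  by (auto simp: qpoch_def)

lemma qpoch_self_nonzero:
  assumes "\<forall>n>0. q ^ n \<noteq> 1"
  shows "qpoch q q n \<noteq> 0"
  using assms by (auto simp: qpoch_eq_0_iff simp flip: power_Suc2)

lemma qpoch_inverse_power_eq_0:
  fixes q :: "'k::field"
  assumes "q \<noteq> 0" "n < k"
  shows "qpoch (inverse (q ^ n)) q k = 0"
  using assms by (auto simp: qpoch_eq_0_iff intro!: exI[of _ n])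

text \<open>
  The right-hand side is a Wilf--Zeilberger certificate for the next lemma: its value at \<open>j = n\<close>
  cancels the last summand \<open>T (Suc n) (Suc n)\<close>.
\<close>

lemma q_saalschuetz_aux:
  fixes q A B D :: "'k::field"
  assumes q: "\<forall>n>0. q ^ n \<noteq> 1"
  defines "T \<equiv> \<lambda>n j. qpoch q q n / (qpoch q q j * qpoch q q (n - j)) * qpoch A q j * qpoch B q j
                 * qpoch D q (n - j) * D ^ j * qpoch (A * B * D * q ^ j) q (n - j)"
  assumes "j \<le> n"
  shows "(\<Sum>i\<le>j. T (Suc n) i - (1 - B * D * q ^ n) * (1 - A * D * q ^ n) * T n i) =
     - (q ^ (n - j) * (qpoch q q n / (qpoch q q j * qpoch q q (n - j))) * qpoch A q (Suc j)
        * qpoch B q (Suc j) * qpoch D q (n - j) * D ^ Suc j * qpoch (A * B * D * q ^ j) q (n - j))"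
  using \<open>j \<le> n\<close>
proof (induction j)
  case 0
  have nz: "qpoch q q n \<noteq> 0" "qpoch q q (Suc n) \<noteq> 0" using qpoch_self_nonzero[OF q] by auto
  have "T (Suc n) 0 = qpoch D q n * (1 - q ^ n * D) * (qpoch (A * B * D) q n * (1 - q ^ n * (A * B * D)))"
    using nz by (simp add: T_def qpoch_Suc[of D] qpoch_Suc[of "A * B * D"])
  moreover have "T n 0 = qpoch D q n * qpoch (A * B * D) q n" using nz by (simp add: T_def)
  ultimately show ?case using nz by (simp add: qpoch_Suc) (simp add: algebra_simps)
next
  case (Suc j)
  then obtain d where n: "n = Suc j + d" using le_Suc_ex by blast
  define X Y where "X = q ^ j" and "Y = q ^ d"
  \<comment> \<open>\<open>U\<close> is common to the two new summands and to both certificate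
    values, at j and at j + 1. Dividing it out leaves the polynomial identity \<open>key\<close> in
    q, X, Y, A, B, D.\<close>
  define U where "U = qpoch q q n / (qpoch q q j * qpoch q q d) * qpoch A q (Suc j) * qpoch B q (Suc j)
       * qpoch D q d * D ^ Suc j * qpoch (A * B * D * q ^ Suc j) q d"
  have nz: "1 - q * X \<noteq> 0" "1 - q * Y \<noteq> 0" "\<And>m. qpoch q q m \<noteq> 0"
    using q[rule_format, of "Suc j"] q[rule_format, of "Suc d"] qpoch_self_nonzero[OF q] by (auto simp: X_def Y_def)
  have qn: "q ^ n = q * X * Y" by (simp add: n X_def Y_def power_add)
  have d: "n - j = Suc d" "n - Suc j = d" "Suc n - Suc j = Suc d" by (simp_all add: n)
  have 1: "T (Suc n) (Suc j) = U * (1 - q * q * X * Y) / ((1 - q * X) * (1 - q * Y)) * (1 - Y * D)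
              * (1 - Y * (A * B * D * (q * X)))"
    using nz
    unfolding T_def U_def d qpoch_Suc[of D q d] qpoch_Suc[of "A * B * D * q ^ Suc j" q d]
      qpoch_Suc[of q q n] qpoch_Suc[of q q j] qpoch_Suc[of q q d] qn
    by (simp add: X_def[symmetric] Y_def[symmetric] field_simps)
  have 2: "T n (Suc j) = U / (1 - q * X)"
    using nz
    unfolding T_def U_def d qpoch_Suc[of q q j]
    by (simp add: X_def[symmetric] Y_def[symmetric] field_simps)
  have 3: "q ^ (n - j) * (qpoch q q n / (qpoch q q j * qpoch q q (n - j))) * qpoch A q (Suc j)
        * qpoch B q (Suc j) * qpoch D q (n - j) * D ^ Suc j * qpoch (A * B * D * q ^ j) q (n - j)
     = U * q * Y * (1 - Y * D) * (1 - A * B * D * X) / (1 - q * Y)"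
  proof -
    have "qpoch (A * B * D * q ^ j) q (Suc d) = (1 - A * B * D * X) * qpoch (A * B * D * q ^ Suc j) q d"
      by (simp add: qpoch_Suc_left X_def mult_ac)
    note * = this
    show ?thesis using nz
      unfolding U_def d qpoch_Suc[of D q d] qpoch_Suc[of q q d] *
      by (simp add: X_def[symmetric] Y_def[symmetric] field_simps)
  qed
  have 4: "q ^ (n - Suc j) * (qpoch q q n / (qpoch q q (Suc j) * qpoch q q (n - Suc j))) * qpoch A q (Suc (Suc j))
        * qpoch B q (Suc (Suc j)) * qpoch D q (n - Suc j) * D ^ Suc (Suc j) * qpoch (A * B * D * q ^ Suc j) q (n - Suc j)
     = U * Y * D * (1 - q * X * A) * (1 - q * X * B) / (1 - q * X)"
    using nz
    unfolding U_def d qpoch_Suc[of A q "Suc j"] qpoch_Suc[of B q "Suc j"] qpoch_Suc[of q q j]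
    by (simp add: X_def[symmetric] Y_def[symmetric] field_simps)
  have key: "(1 - q * q * X * Y) * (1 - Y * D) * (1 - Y * (A * B * D * (q * X)))
      - (1 - B * D * (q * X * Y)) * (1 - A * D * (q * X * Y)) * (1 - q * Y)
      - q * Y * (1 - Y * D) * (1 - A * B * D * X) * (1 - q * X)
      + Y * D * (1 - q * X * A) * (1 - q * X * B) * (1 - q * Y) = 0"
    by algebra
  have comb: "U * a / (p * r) * a1 * a2 - L * (U / p) - U * q * Y * b * b' / r + U * Y * D * c * c' / p
      = U / (p * r) * (a * a1 * a2 - L * r - q * Y * b * b' * p + Y * D * c * c' * r)"
    if "p \<noteq> 0" "r \<noteq> 0" for a a1 a2 p r L b b' c c' :: 'k
    using that by (simp add: field_simps)
  have "T (Suc n) (Suc j) - (1 - B * D * q ^ n) * (1 - A * D * q ^ n) * T n (Suc j)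
      - U * q * Y * (1 - Y * D) * (1 - A * B * D * X) / (1 - q * Y)
      + U * Y * D * (1 - q * X * A) * (1 - q * X * B) / (1 - q * X)
     = U / ((1 - q * X) * (1 - q * Y)) * ((1 - q * q * X * Y) * (1 - Y * D) * (1 - Y * (A * B * D * (q * X)))
      - (1 - B * D * (q * X * Y)) * (1 - A * D * (q * X * Y)) * (1 - q * Y)
      - q * Y * (1 - Y * D) * (1 - A * B * D * X) * (1 - q * X)
      + Y * D * (1 - q * X * A) * (1 - q * X * B) * (1 - q * Y))"
    unfolding 1 2 qn using nz(1,2) by (intro comb)
  also have "\<dots> = 0" unfolding key by simp
  finally have eq0: "T (Suc n) (Suc j) - (1 - B * D * q ^ n) * (1 - A * D * q ^ n) * T n (Suc j)
      - U * q * Y * (1 - Y * D) * (1 - A * B * D * X) / (1 - q * Y)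
      + U * Y * D * (1 - q * X * A) * (1 - q * X * B) / (1 - q * X) = 0" .
  have *: "S + u = - h" if "S = - g" "u - g + h = 0" for S u g h :: 'k
    using that by (simp add: add_eq_0_iff)
  show ?case
    unfolding sum.atMost_Suc 4 by (rule *[OF _ eq0]) (use Suc.IH Suc.prems 3 in simp)
qed

text \<open>Clearing the denominators of the q-Saalschuetz sum makes both sides polynomial in A, B,
  D, so that the identity holds for all their values and can be inserted at every index of another
  sum. The certificate at j = n yields the recurrence S(n+1) = (1 - BDq^n)(1 - ADq^n) S(n) of the
  right-hand side.\<close>

lemma q_saalschuetz_polynomial:
  fixes q A B D :: "'k::field"
  assumes q: "\<forall>n>0. q ^ n \<noteq> 1"
  shows "(\<Sum>j\<le>n. qpoch q q n / (qpoch q q j * qpoch q q (n - j)) * qpoch A q j * qpoch B q j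
            * qpoch D q (n - j) * D ^ j * qpoch (A * B * D * q ^ j) q (n - j))
         = qpoch (B * D) q n * qpoch (A * D) q n"
proof (induction n)
  case (Suc n)
  define T where "T = (\<lambda>n j. qpoch q q n / (qpoch q q j * qpoch q q (n - j)) * qpoch A q j * qpoch B q j
                 * qpoch D q (n - j) * D ^ j * qpoch (A * B * D * q ^ j) q (n - j))"
  have nz: "qpoch q q m \<noteq> 0" for m using qpoch_self_nonzero[OF q] by auto
  let ?L = "(1 - B * D * q ^ n) * (1 - A * D * q ^ n)"
  have "(\<Sum>j\<le>n. T (Suc n) j) - ?L * (\<Sum>j\<le>n. T n j) = (\<Sum>j\<le>n. T (Suc n) j - ?L * T n j)"
    by (simp add: sum_subtractf sum_distrib_left)
  also have "\<dots> = - T (Suc n) (Suc n)"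
    using q_saalschuetz_aux[OF q order.refl[of n], where A = A and B = B and D = D] nz by (simp add: T_def)
  finally have "(\<Sum>j\<le>Suc n. T (Suc n) j) = ?L * (\<Sum>j\<le>n. T n j)" by (simp add: algebra_simps)
  also have "(\<Sum>j\<le>n. T n j) = qpoch (B * D) q n * qpoch (A * D) q n" using Suc by (simp add: T_def)
  finally show ?case by (simp add: T_def qpoch_Suc mult_ac)
qed auto

text \<open>By the hypothesis q^i E and q^(n-1-i) D are inverse to each other, so the factor 1 - q^i
  E times -D q^(n-1-i) is the factor 1 - q^(n-1-i) D. The factors of E thus supply the last m
  factors of (D;q)_n. The exponent of q stays an unevaluated sum because it cancels wherever two
  reversals are compared.\<close>

lemma qpoch_reverse_mult:
  fixes q D E :: "'k::field"
  assumes "q \<noteq> 0" "E * D * q ^ n = q" "m \<le> n"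
  shows "qpoch E q m * qpoch D q (n - m) * (- D) ^ m * q ^ (\<Sum>i<m. n - 1 - i) = qpoch D q n"
  using \<open>m \<le> n\<close>
proof (induction m)
  case (Suc m)
  then obtain d where n: "n = Suc m + d" using le_Suc_ex by blast
  have d: "n - m = Suc d" "n - Suc m = d" "n - 1 - m = d" by (simp_all add: n)
  have "q * (q ^ m * E * (D * q ^ d)) = q * 1"
    using assms(2) by (simp add: n power_add mult_ac)
  then have "q ^ m * E * (D * q ^ d) = 1" using \<open>q \<noteq> 0\<close> by (subst (asm) mult_cancel_left) simp
  then have "(1 - q ^ m * E) * (- D) * q ^ d = 1 - q ^ d * D" by (simp add: algebra_simps)
  then have *: "(1 - q ^ m * E) * qpoch D q d * (- D) * q ^ d = qpoch D q (Suc d)"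
    by (simp add: qpoch_Suc algebra_simps)
  have "qpoch E q (Suc m) * qpoch D q (n - Suc m) * (- D) ^ Suc m * q ^ (\<Sum>i<Suc m. n - 1 - i)
    = qpoch E q m * ((1 - q ^ m * E) * qpoch D q d * (- D) * q ^ d) * (- D) ^ m * q ^ (\<Sum>i<m. n - 1 - i)"
    unfolding d qpoch_Suc[of E] by (simp add: power_add mult_ac d)
  also have "\<dots> = qpoch D q n"
    unfolding * using Suc by (simp add: d)
  finally show ?case .
qed simp

text \<open>Reversing the factorials of q^(-n) and E turns each summand into one of the polynomial
  form. In the usual notation C = ABD, so BD = C/A, AD = C/B, D = C/(AB), and \<open>ED\<close> is
  the balancing condition of the 3phi2 series.\<close>

lemma q_saalschuetz:
  fixes q A B D E :: "'k::field"
  assumes q: "\<forall>n>0. q ^ n \<noteq> 1" and "q \<noteq> 0" "D \<noteq> 0"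
    and ED: "E * D * q ^ n = q"
    and nzC: "qpoch (A * B * D) q n \<noteq> 0" and nzE: "qpoch E q n \<noteq> 0"
  shows "(\<Sum>m\<le>n. qpoch (inverse (q ^ n)) q m * qpoch A q m * qpoch B q m
            / (qpoch q q m * qpoch (A * B * D) q m * qpoch E q m) * q ^ m)
         = qpoch (B * D) q n * qpoch (A * D) q n / (qpoch (A * B * D) q n * qpoch D q n)"
proof -
  have nz: "qpoch q q m \<noteq> 0" for m using qpoch_self_nonzero[OF q] by auto
  have nzD: "qpoch D q n \<noteq> 0"
    using qpoch_reverse_mult[OF \<open>q \<noteq> 0\<close> ED order.refl] nzE \<open>q \<noteq> 0\<close> \<open>D \<noteq> 0\<close> by auto
  have qn: "inverse (q ^ n) * q * q ^ n = q" using \<open>q \<noteq> 0\<close> by simp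
  have "qpoch (inverse (q ^ n)) q m * qpoch A q m * qpoch B q m
            / (qpoch q q m * qpoch (A * B * D) q m * qpoch E q m) * q ^ m
      = (qpoch q q n / (qpoch q q m * qpoch q q (n - m)) * qpoch A q m * qpoch B q m
            * qpoch D q (n - m) * D ^ m * qpoch (A * B * D * q ^ m) q (n - m))
         / (qpoch (A * B * D) q n * qpoch D q n)" if "m \<le> n" for m
  proof -
    define W where "W = q ^ (\<Sum>i<m. n - 1 - i)"
    have W: "W \<noteq> 0" using \<open>q \<noteq> 0\<close> by (simp add: W_def)
    have E: "qpoch E q m * qpoch D q (n - m) * (- D) ^ m * W = qpoch D q n"
      unfolding W_def by (rule qpoch_reverse_mult) (use assms that in auto)
    \<comment> \<open>The same reversal, with q in the role of D; its power \<open>W\<close> agrees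
      with the one for E, so it cancels in the quotient.\<close>
    have I: "qpoch (inverse (q ^ n)) q m * qpoch q q (n - m) * (- q) ^ m * W = qpoch q q n"
      unfolding W_def by (rule qpoch_reverse_mult) (use assms that qn in auto)
    have C: "qpoch (A * B * D) q n = qpoch (A * B * D) q m * qpoch (A * B * D * q ^ m) q (n - m)"
      using qpoch_add[of "A * B * D" q m "n - m"] that by (simp add: mult_ac)
    have nz': "qpoch (A * B * D) q m \<noteq> 0" "qpoch (A * B * D * q ^ m) q (n - m) \<noteq> 0"
      using nzC C by auto
    have nz'': "qpoch E q m \<noteq> 0" "qpoch D q (n - m) \<noteq> 0" using E nzD by auto
    have *: "i * a * b / (qm * cm * e) * Q = (i * qnm * (s * Q) * W) / (qm * qnm) * a * b * dnm * d * c'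
               / (cm * c' * (e * dnm * (s * d) * W))"
      if "qm \<noteq> 0" "cm \<noteq> 0" "e \<noteq> 0" "qnm \<noteq> 0" "s \<noteq> 0" "dnm \<noteq> 0" "d \<noteq> 0" "c' \<noteq> 0"
      for i a b qm cm e Q qnm s dnm d c' :: 'k
      using that W by (simp add: field_simps)
    show ?thesis
      unfolding C unfolding E[symmetric] I[symmetric] power_minus[of D] power_minus[of q]
      by (rule *) (use nz nz' nz'' \<open>D \<noteq> 0\<close> in auto)
  qed
  then have "(\<Sum>m\<le>n. qpoch (inverse (q ^ n)) q m * qpoch A q m * qpoch B q m
            / (qpoch q q m * qpoch (A * B * D) q m * qpoch E q m) * q ^ m)
      = (\<Sum>m\<le>n. qpoch q q n / (qpoch q q m * qpoch q q (n - m)) * qpoch A q m * qpoch B q m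
            * qpoch D q (n - m) * D ^ m * qpoch (A * B * D * q ^ m) q (n - m))
         / (qpoch (A * B * D) q n * qpoch D q n)"
    by (simp add: sum_divide_distrib)
  then show ?thesis using q_saalschuetz_polynomial[OF q, where n = n and A = A and B = B and D = D] by simp
qed

section \<open>Sears' transformation\<close>

lemma sum_triangle_swap:
  fixes g :: "nat \<Rightarrow> nat \<Rightarrow> 'B_term::comm_monoid_add"
  shows "(\<Sum>k\<le>n. \<Sum>l\<le>k. g k l) = (\<Sum>l\<le>n. \<Sum>m\<le>n - l. g (l + m) l)"
  unfolding sum.Sigma[OF finite_atMost ballI[OF finite_atMost]]
  by (rule sum.reindex_bij_witness[of _ "\<lambda>(l, m). (l + m, l)" "\<lambda>(k, l). (l, k - l)"]) auto

text \<open>The polynomial q-Saalschuetz sum expands (BD)_k (AD)_k / (ABD)_k. After exchanging the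
  order of summation the inner sum is again a balanced 3phi2, and \<open>ef\<close> is the balancing
  condition of the whole series. The quotient depending on n - l is not yet in its usual form; its
  factorials are reversed in the application.\<close>

lemma sears:
  fixes q A B D a e f :: "'k::field"
  assumes q: "\<forall>n>0. q ^ n \<noteq> 1" and "q \<noteq> 0" "a \<noteq> 0" "D \<noteq> 0" "e \<noteq> 0"
    and ef: "e * f * q ^ n = a * D * q"
    and nzC: "qpoch (A * B * D) q n \<noteq> 0" and nze: "qpoch e q n \<noteq> 0" and nzf: "qpoch f q n \<noteq> 0"
  shows "(\<Sum>k\<le>n. qpoch (inverse (q ^ n)) q k * qpoch a q k * qpoch (B * D) q k * qpoch (A * D) q k
            / (qpoch q q k * qpoch (A * B * D) q k * qpoch e q k * qpoch f q k) * q ^ k)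
       = (\<Sum>l\<le>n. qpoch (inverse (q ^ n)) q l * qpoch a q l * qpoch A q l * qpoch B q l
            / (qpoch q q l * qpoch (A * B * D) q l * qpoch e q l * qpoch f q l) * (D * q) ^ l
            * (qpoch (e / a) q (n - l) * qpoch (e * q ^ l / D) q (n - l)
                / (qpoch (e * q ^ l) q (n - l) * qpoch (e / (a * D)) q (n - l))))"
proof -
  have nzq: "qpoch q q m \<noteq> 0" for m using qpoch_self_nonzero[OF q] by auto
  define g where "g = (\<lambda>k l. qpoch (inverse (q ^ n)) q k * qpoch a q k * qpoch A q l * qpoch B q l
      * qpoch D q (k - l) * D ^ l / (qpoch q q l * qpoch q q (k - l) * qpoch (A * B * D) q l
           * qpoch e q k * qpoch f q k) * q ^ k)"
  have split: "qpoch z q n = qpoch z q l * qpoch (z * q ^ l) q (n - l)" if "l \<le> n" for z l n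
    using qpoch_add[of z q l "n - l"] that by (simp add: mult_ac)
  have nzC': "qpoch (A * B * D) q k \<noteq> 0" if "k \<le> n" for k
    using nzC split[OF that, of "A * B * D"] by auto
  have 1: "qpoch (inverse (q ^ n)) q k * qpoch a q k * qpoch (B * D) q k * qpoch (A * D) q k
            / (qpoch q q k * qpoch (A * B * D) q k * qpoch e q k * qpoch f q k) * q ^ k
        = (\<Sum>l\<le>k. g k l)" if k: "k \<le> n" for k
  proof -
    have "qpoch (inverse (q ^ n)) q k * qpoch a q k * qpoch (B * D) q k * qpoch (A * D) q k
            / (qpoch q q k * qpoch (A * B * D) q k * qpoch e q k * qpoch f q k) * q ^ k
      = qpoch (inverse (q ^ n)) q k * qpoch a q k * (\<Sum>j\<le>k. qpoch q q k / (qpoch q q j * qpoch q q (k - j)) * qpoch A q j * qpoch B q j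
            * qpoch D q (k - j) * D ^ j * qpoch (A * B * D * q ^ j) q (k - j))
            / (qpoch q q k * qpoch (A * B * D) q k * qpoch e q k * qpoch f q k) * q ^ k"
      unfolding q_saalschuetz_polynomial[OF q] by simp
    also have "\<dots> = (\<Sum>j\<le>k. qpoch (inverse (q ^ n)) q k * qpoch a q k * (qpoch q q k / (qpoch q q j * qpoch q q (k - j)) * qpoch A q j * qpoch B q j
            * qpoch D q (k - j) * D ^ j * qpoch (A * B * D * q ^ j) q (k - j))
            / (qpoch q q k * qpoch (A * B * D) q k * qpoch e q k * qpoch f q k) * q ^ k)"
      by (simp only: sum_distrib_left sum_distrib_right sum_divide_distrib)
    also have "\<dots> = (\<Sum>l\<le>k. g k l)"
    proof (rule sum.cong[OF refl])
      fix j assume "j \<in> {..k}"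
      then have j: "j \<le> k" by simp
      have nz': "qpoch (A * B * D) q j \<noteq> 0" "qpoch (A * B * D * q ^ j) q (k - j) \<noteq> 0"
        using nzC'[OF k] split[OF j, of "A * B * D"] by auto
      have *: "i * \<alpha> * (qk / (qj * qkj) * \<beta> * \<gamma> * \<delta> * \<epsilon> * C') / (qk * (C * C') * E * F) * Q
          = i * \<alpha> * \<beta> * \<gamma> * \<delta> * \<epsilon> / (qj * qkj * C * E * F) * Q" if "qk \<noteq> 0" "C' \<noteq> 0"
        for i \<alpha> qk qj qkj \<beta> \<gamma> \<delta> \<epsilon> C' C E F Q :: 'k
        using that by (simp add: mult_ac)
      show "qpoch (inverse (q ^ n)) q k * qpoch a q k * (qpoch q q k / (qpoch q q j * qpoch q q (k - j)) * qpoch A q j * qpoch B q j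
            * qpoch D q (k - j) * D ^ j * qpoch (A * B * D * q ^ j) q (k - j))
            / (qpoch q q k * qpoch (A * B * D) q k * qpoch e q k * qpoch f q k) * q ^ k = g k j"
        unfolding g_def split[OF j, of "A * B * D"] by (rule *) (use nzq nz' in auto)
    qed
    finally show ?thesis .
  qed
  have 2: "(\<Sum>m\<le>n - l. g (l + m) l) = qpoch (inverse (q ^ n)) q l * qpoch a q l * qpoch A q l * qpoch B q l
            / (qpoch q q l * qpoch (A * B * D) q l * qpoch e q l * qpoch f q l) * (D * q) ^ l
            * (qpoch (e / a) q (n - l) * qpoch (e * q ^ l / D) q (n - l)
                / (qpoch (e * q ^ l) q (n - l) * qpoch (e / (a * D)) q (n - l)))" if l: "l \<le> n" for l
  proof -
    define N where "N = n - l"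
    \<comment> \<open>The inner series has upper parameters q^(-N), a q^l, D and lower ones e q^l, f
      q^l. So \<open>D'\<close> is the quotient (e q^l) / (a q^l D), which is independent of l, and
      fact \<open>3\<close> is the balancing condition inherited from \<open>ef\<close>.\<close>
    define D' where "D' = e / (a * D)"
    have nN: "q ^ n = q ^ l * q ^ N" using l by (simp add: N_def flip: power_add)
    have *: "q ^ l * inverse (q ^ n) = inverse (q ^ N)" using \<open>q \<noteq> 0\<close> by (simp add: nN)
    have D': "D' \<noteq> 0" "a * q ^ l * D * D' = e * q ^ l" "D * D' = e / a" "a * q ^ l * D' = e * q ^ l / D"
      using assms by (auto simp: D'_def)
    have 3: "f * q ^ l * D' * q ^ N = q"
      using ef \<open>a \<noteq> 0\<close> \<open>D \<noteq> 0\<close> by (simp add: D'_def nN field_simps)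
    have "g (l + m) l = qpoch (inverse (q ^ n)) q l * qpoch a q l * qpoch A q l * qpoch B q l
            / (qpoch q q l * qpoch (A * B * D) q l * qpoch e q l * qpoch f q l) * (D * q) ^ l
         * (qpoch (inverse (q ^ N)) q m * qpoch (a * q ^ l) q m * qpoch D q m
            / (qpoch q q m * qpoch (e * q ^ l) q m * qpoch (f * q ^ l) q m) * q ^ m)" for m
      unfolding g_def qpoch_add * by (simp add: power_add power_mult_distrib mult_ac)
    then have "(\<Sum>m\<le>N. g (l + m) l) = qpoch (inverse (q ^ n)) q l * qpoch a q l * qpoch A q l * qpoch B q l
            / (qpoch q q l * qpoch (A * B * D) q l * qpoch e q l * qpoch f q l) * (D * q) ^ l
         * (\<Sum>m\<le>N. qpoch (inverse (q ^ N)) q m * qpoch (a * q ^ l) q m * qpoch D q m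
            / (qpoch q q m * qpoch (e * q ^ l) q m * qpoch (f * q ^ l) q m) * q ^ m)"
      by (simp add: sum_distrib_left)
    also have "(\<Sum>m\<le>N. qpoch (inverse (q ^ N)) q m * qpoch (a * q ^ l) q m * qpoch D q m
            / (qpoch q q m * qpoch (e * q ^ l) q m * qpoch (f * q ^ l) q m) * q ^ m)
        = qpoch (e / a) q N * qpoch (e * q ^ l / D) q N
                / (qpoch (e * q ^ l) q N * qpoch D' q N)"
      using q_saalschuetz[OF q \<open>q \<noteq> 0\<close> D'(1) 3, of "a * q ^ l" D, unfolded D'(2-4)]
        nze nzf split[OF l, of e] split[OF l, of f] by (auto simp: N_def)
    finally show ?thesis by (simp add: N_def D'_def)
  qed
  have "(\<Sum>k\<le>n. qpoch (inverse (q ^ n)) q k * qpoch a q k * qpoch (B * D) q k * qpoch (A * D) q k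
            / (qpoch q q k * qpoch (A * B * D) q k * qpoch e q k * qpoch f q k) * q ^ k) = (\<Sum>k\<le>n. \<Sum>l\<le>k. g k l)"
    by (intro sum.cong refl) (use 1 in auto)
  also have "\<dots> = (\<Sum>l\<le>n. \<Sum>m\<le>n - l. g (l + m) l)" by (rule sum_triangle_swap)
  also have "\<dots> = (\<Sum>l\<le>n. qpoch (inverse (q ^ n)) q l * qpoch a q l * qpoch A q l * qpoch B q l
            / (qpoch q q l * qpoch (A * B * D) q l * qpoch e q l * qpoch f q l) * (D * q) ^ l
            * (qpoch (e / a) q (n - l) * qpoch (e * q ^ l / D) q (n - l)
                / (qpoch (e * q ^ l) q (n - l) * qpoch (e / (a * D)) q (n - l))))"
    by (intro sum.cong refl) (use 2 in auto)
  finally show ?thesis .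
qed

text \<open>
  \<open>B(s,j)\<close> with \<open>x = a\<^sup>2\<close>, \<open>y = c\<^sup>2\<close> and the common factor \<open>1 - s\<^sup>2/t\<^sup>2\<close> cancelled, so that
  it has no pole at \<open>s = t\<close>.
\<close>

definition B_red :: "'k::field \<Rightarrow> 'k \<Rightarrow> 'k \<Rightarrow> 'k \<Rightarrow> nat \<Rightarrow> 'k" where
  "B_red x y t s j = (if j = 0 then 1 else
     (-1) ^ j * inverse s ^ j * (qpoch (s^2) (t^2) (j - 1) / qpoch (t^2) (t^2) j)
     * (1 - s^2 * (t^2) ^ (2 * j) / t^2)
     * (\<Sum>k\<le>j. qpoch (inverse ((t^2) ^ j)) (t^2) k * qpoch (s^2 * (t^2) ^ j / t^2) (t^2) k
           * qpoch (- s * x) (t^2) k * qpoch (- s * y) (t^2) k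
           / (qpoch (t^2) (t^2) k * qpoch (- s) (t^2) k * qpoch (- s * t) (t^2) k
              * qpoch (s^2 * (x * y) / t) (t^2) k) * (t^2) ^ k))"

section \<open>Generic parameters and regular points\<close>

locale generic =
  fixes x y t :: "'k::field"
  assumes x: "x \<noteq> 0" and y: "y \<noteq> 0" and t: "t \<noteq> 0"
    and t_power: "\<And>n::nat. n > 0 \<Longrightarrow> t ^ n \<noteq> 1"
    and xy_power: "\<And>n::int. odd n \<Longrightarrow> x * y \<noteq> t powi n"
begin

text \<open>
  Excludes the poles of \<^const>\<open>B_red\<close> in a way that is stable under replacing \<open>s\<close> by \<open>s t\<close> or \<open>s/t\<close>.
\<close>

definition regular :: "'k \<Rightarrow> bool" where
  "regular s \<longleftrightarrow> s \<noteq> 0 \<and> (\<forall>n::int. s * t powi n \<noteq> - 1) \<and> (\<forall>n::int. odd n \<longrightarrow> s^2 * (x * y) \<noteq> t powi n)"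

lemma regular_shift:
  assumes "regular s"
  shows "regular (s * t powi m)"
  unfolding regular_def
proof (intro conjI allI impI)
  show "s * t powi m \<noteq> 0" using assms t by (auto simp: regular_def)
  show "s * t powi m * t powi n \<noteq> - 1" for n
    using assms t by (simp add: regular_def mult.assoc flip: power_int_add)
  fix n :: int assume "odd n"
  then have "odd (n - 2 * m)" by simp
  then have "s\<^sup>2 * (x * y) \<noteq> t powi (n - 2 * m)" using assms by (auto simp: regular_def)
  moreover have "(t powi m)\<^sup>2 * t powi (n - 2 * m) = t powi n"
    using t by (simp add: power_int_add[symmetric] power2_eq_square)
  moreover have "t powi m \<noteq> 0" using t by simp
  ultimately have "(t powi m)\<^sup>2 * (s\<^sup>2 * (x * y)) \<noteq> t powi n"
    by (metis mult_cancel_left power_not_zero)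
  then show "(s * t powi m)\<^sup>2 * (x * y) \<noteq> t powi n" by (simp add: power_mult_distrib mult_ac)
qed

lemma regular_mult: "regular s \<Longrightarrow> regular (s * t)"
  using regular_shift[of s 1] by simp

lemma regular_divide: "regular s \<Longrightarrow> regular (s / t)"
  using regular_shift[of s "-1"] by (simp add: power_int_minus divide_inverse)

lemma t2_power: "\<forall>n>0. (t^2) ^ n \<noteq> 1"
  using t_power by (metis nat_0_less_mult_iff pos2 power_mult)

lemma qpoch_self: "qpoch (t^2) (t^2) n \<noteq> 0"
  by (intro qpoch_self_nonzero t2_power)

lemma qpoch_minus_nonzero:
  assumes "regular s"
  shows "qpoch (- (s * t powi m)) (t^2) n \<noteq> 0"
proof
  assume "qpoch (- (s * t powi m)) (t^2) n = 0"
  then obtain j where "(t^2) ^ j * (- (s * t powi m)) = 1" by (auto simp: qpoch_eq_0_iff)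
  moreover have "(t^2) ^ j = t powi (2 * int j)"
    by (simp add: power_int_mult)
  ultimately have "- (s * t powi (2 * int j + m)) = 1"
    using t by (simp add: power_int_add mult_ac)
  then have "s * t powi (2 * int j + m) = - 1" by (metis minus_minus)
  then show False using assms by (auto simp: regular_def)
qed

lemma qpoch_odd_nonzero:
  assumes "regular s" "odd m"
  shows "qpoch (s^2 * (x * y) * t powi m) (t^2) n \<noteq> 0"
proof
  assume "qpoch (s^2 * (x * y) * t powi m) (t^2) n = 0"
  then obtain j where "(t^2) ^ j * (s^2 * (x * y) * t powi m) = 1" by (auto simp: qpoch_eq_0_iff)
  moreover have "(t^2) ^ j = t powi (2 * int j)"
    by (simp add: power_int_mult)
  ultimately have "s^2 * (x * y) * t powi (2 * int j + m) = 1"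
    using t by (simp add: power_int_add mult_ac)
  then have "s^2 * (x * y) = t powi (- (2 * int j + m))"
    using t unfolding power_int_minus by (metis inverse_unique mult.commute)
  moreover have "odd (- (2 * int j + m))" using assms by simp
  ultimately show False using assms(1) unfolding regular_def by blast
qed

lemma qpoch_t_div_xy_nonzero: "qpoch (t / (x * y)) (t^2) n \<noteq> 0"
proof
  assume "qpoch (t / (x * y)) (t^2) n = 0"
  then obtain j where "(t^2) ^ j * (t / (x * y)) = 1" by (auto simp: qpoch_eq_0_iff)
  then have "x * y = t powi (int (2 * j + 1))"
    unfolding power_int_of_nat using x y by (simp add: field_simps flip: power_mult)
  then show False using xy_power[of "int (2 * j + 1)"] by simp
qed

section \<open>Expansion of B in products independent of s\<close>

abbreviation B0 :: "'k \<Rightarrow> nat \<Rightarrow> 'k" where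
  "B0 \<equiv> B_red x y t"

text \<open>
  Sears' transformation makes the numerator parameters \<open>-sx\<close>, \<open>-sy\<close> independent of \<open>s\<close>. Their
  contribution is \<open>R k\<close>, and the coefficient \<open>B_term s j k\<close> of \<open>R k\<close> depends on \<open>x\<close>, \<open>y\<close> only
  through \<open>x y\<close>.
\<close>

definition R :: "nat \<Rightarrow> 'k" where
  "R k = qpoch (1 / x) (t^2) k * qpoch (1 / y) (t^2) k / qpoch (t / (x * y)) (t^2) k"

definition B_term :: "'k \<Rightarrow> nat \<Rightarrow> nat \<Rightarrow> 'k" where
  "B_term s j k = (if j = 0 then (if k = 0 then 1 else 0) else
     (x * y) ^ j * qpoch (t / (x * y)) (t^2) j / qpoch (s^2 * (x * y) / t) (t^2) j
     * (1 - s * (t^2) ^ j / t) * (1 + s / t)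
     * qpoch (s^2) (t^2) (j + k - 1) * qpoch (inverse ((t^2) ^ j)) (t^2) k * (t^2) ^ k
     / (qpoch (t^2) (t^2) j * qpoch (t^2) (t^2) k * qpoch (- s) (t^2) k * qpoch (- s / t) (t^2) k))"

text \<open>Sears' transformation with A = 1/x, B = 1/y, D = -sxy gives ABD = -s, BD = -sx, AD =
  -sy; the other parameters are a = s^2 t^(2j-2), e = -st, f = s^2xy/t. What does not depend on k is
  collected in \<open>?G\<close> and merges with the prefactor of B into \<open>?H\<close>.\<close>

lemma B_red_eq_sum:
  assumes s: "regular s"
  shows "B0 s j = (\<Sum>k\<le>j. B_term s j k * R k)"
proof (cases j)
  case 0
  then show ?thesis by (simp add: B_red_def B_term_def R_def)
next
  case (Suc j')
  define q where "q = t^2"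
  define P where "P = x * y"
  define a where "a = s^2 * q ^ j / q"
  have nz: "s \<noteq> 0" "q \<noteq> 0" "P \<noteq> 0" "a \<noteq> 0"
    using s x y t by (auto simp: regular_def q_def P_def a_def)
  have q: "\<forall>n>0. q ^ n \<noteq> 1"
    using t2_power unfolding q_def .
  have n1: "qpoch (- s) q n \<noteq> 0" for n using qpoch_minus_nonzero[OF s, of 0 n] by (simp add: q_def)
  have n2: "qpoch (- s * t) q n \<noteq> 0" for n using qpoch_minus_nonzero[OF s, of 1 n] by (simp add: q_def)
  have n3: "qpoch (- s / t) q n \<noteq> 0" for n
    using qpoch_minus_nonzero[OF s, of "-1" n] by (simp add: q_def divide_inverse power_int_minus)
  have n4: "qpoch (s^2 * P / t) q n \<noteq> 0" for n
    using qpoch_odd_nonzero[OF s, of "-1" n] by (simp add: q_def P_def divide_inverse power_int_minus)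
  have n5: "qpoch (t / P) q n \<noteq> 0" for n using qpoch_t_div_xy_nonzero by (simp add: q_def P_def)
  have split: "qpoch z q n = qpoch z q l * qpoch (z * q ^ l) q (n - l)" if "l \<le> n" for z l n
    using qpoch_add[of z q l "n - l"] that by (simp add: mult_ac)
  let ?G = "(- s * P) ^ j * qpoch (- s / t) q j * qpoch (t / P) q j
                / (qpoch (- s * t) q j * qpoch (s^2 * P / t) q j)"
  have "(\<Sum>k\<le>j. qpoch (inverse (q ^ j)) q k * qpoch a q k
           * qpoch (- s * x) q k * qpoch (- s * y) q k
           / (qpoch q q k * qpoch (- s) q k * qpoch (- s * t) q k
              * qpoch (s^2 * P / t) q k) * q ^ k)
     = (\<Sum>k\<le>j. qpoch (inverse (q ^ j)) q k * qpoch a q k * qpoch (1 / x) q k * qpoch (1 / y) q k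
            / (qpoch q q k * qpoch (- s) q k * qpoch (- s * t) q k * qpoch (s^2 * P / t) q k) * (- s * P * q) ^ k
            * (qpoch (- s * t / a) q (j - k) * qpoch (- s * t * q ^ k / (- s * P)) q (j - k)
                / (qpoch (- s * t * q ^ k) q (j - k) * qpoch (- s * t / (a * (- s * P))) q (j - k))))"
  proof -
    have *: "1 / x * (1 / y) * (- s * P) = - s" "1 / y * (- s * P) = - s * x" "1 / x * (- s * P) = - s * y"
      using x y by (auto simp: P_def)
    show ?thesis
      by (rule sears[where A = "1 / x" and B = "1 / y" and D = "- s * P" and e = "- s * t" and f = "s^2 * P / t", unfolded *])
         (use q nz n1 n2 n4 t in \<open>auto simp: a_def field_simps power2_eq_square\<close>)
  qed
  also have "\<dots> = (\<Sum>k\<le>j. ?G * (qpoch (inverse (q ^ j)) q k * qpoch a q k * q ^ k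
               / (qpoch q q k * qpoch (- s) q k * qpoch (- s / t) q k) * R k))"
  proof (rule sum.cong[OF refl])
    fix k assume "k \<in> {..j}"
    then have k: "k \<le> j" by simp
    define N where "N = j - k"
    \<comment> \<open>Reversing (e/a)_N and (e/(aD))_N leads to \<open>z\<close> and
      \<open>z'\<close>, which start the tails, from index k on, of (-s/t;q)_j and (s^2xy/t;q)_j. In
      the quotient only (-sxy)^N remains besides the tails, and the tails complete the factorials at
      k to factorials at j.\<close>
    define z z' where "z = - s / t * q ^ k" and "z' = s^2 * P / t * q ^ k"
    define W where "W = q ^ (\<Sum>i<N. N - 1 - i)"
    have z: "z \<noteq> 0" "z' \<noteq> 0" "W \<noteq> 0" using nz t by (auto simp: z_def z'_def W_def)
    have z': "- z' = (- s * P) * (- z)" using nz t by (simp add: z_def z'_def field_simps power2_eq_square)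
    have qj: "q ^ j = q ^ k * q ^ N" using k by (simp add: N_def flip: power_add)
    have r1: "qpoch (- s * t / a) q N * (- z) ^ N * W = qpoch z q N"
      using qpoch_reverse_mult[OF \<open>q \<noteq> 0\<close>, of "- s * t / a" z N N] nz t
      by (simp add: W_def a_def z_def qj field_simps power2_eq_square)
    have r2: "qpoch (- s * t / (a * (- s * P))) q N * (- z') ^ N * W = qpoch z' q N"
      using qpoch_reverse_mult[OF \<open>q \<noteq> 0\<close>, of "- s * t / (a * (- s * P))" z' N N] nz t
      by (simp add: W_def a_def z'_def qj field_simps power2_eq_square)
    have z'0: "qpoch z' q N \<noteq> 0" using n4[of j] split[OF k, of "s^2 * P / t"] by (auto simp: z'_def N_def)
    have D0: "qpoch (- s * t / (a * (- s * P))) q N \<noteq> 0" using z'0 r2 by auto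
    have r3: "qpoch (- s * t / a) q N / qpoch (- s * t / (a * (- s * P))) q N
        = (- s * P) ^ N * qpoch z q N / qpoch z' q N"
      using z D0 nz unfolding r1[symmetric] r2[symmetric] z' power_mult_distrib[of "- s * P"]
      by (simp add: field_simps)
    have e1: "- s * t * q ^ k / (- s * P) = t / P * q ^ k" using nz by (simp add: field_simps)
    have s1: "qpoch (- s / t) q j = qpoch (- s / t) q k * qpoch z q N"
      using split[OF k] by (simp add: z_def N_def)
    have s2: "qpoch (s^2 * P / t) q j = qpoch (s^2 * P / t) q k * qpoch z' q N"
      using split[OF k] by (simp add: z'_def N_def)
    have s3: "qpoch (t / P) q j = qpoch (t / P) q k * qpoch (t / P * q ^ k) q N"
      using split[OF k] by (simp add: N_def)
    have s4: "qpoch (- s * t) q j = qpoch (- s * t) q k * qpoch (- s * t * q ^ k) q N"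
      using split[OF k] by (simp add: N_def)
    have s5: "(- s * P) ^ j = (- s * P) ^ k * (- s * P) ^ N"
      using k by (simp add: N_def flip: power_add)
    have c: "i * \<alpha> * u * v / (qk * m * st * sP) * (d * Q) * (E1 * E2 / (E3 * E4))
          = d * d' * (mt * zN) * (tP * E2) / (st * E3 * (sP * zN')) * (i * \<alpha> * Q / (qk * m * mt) * (u * v / tP))"
      if "E1 / E4 = d' * zN / zN'" "mt \<noteq> 0" "tP \<noteq> 0"
      for i \<alpha> u v qk m st sP d Q E1 E2 E3 E4 d' mt zN tP zN' :: 'k
    proof -
      have "i * \<alpha> * u * v / (qk * m * st * sP) * (d * Q) * (E1 * E2 / (E3 * E4))
         = i * \<alpha> * u * v / (qk * m * st * sP) * (d * Q) * (E2 / E3) * (E1 / E4)" by (simp add: mult_ac)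
      also have "\<dots> = d * d' * (mt * zN) * (tP * E2) / (st * E3 * (sP * zN')) * (i * \<alpha> * Q / (qk * m * mt) * (u * v / tP))"
        unfolding that(1) using that(2,3) by (simp add: mult_ac)
      finally show ?thesis .
    qed
    show "qpoch (inverse (q ^ j)) q k * qpoch a q k * qpoch (1 / x) q k * qpoch (1 / y) q k
            / (qpoch q q k * qpoch (- s) q k * qpoch (- s * t) q k * qpoch (s^2 * P / t) q k) * (- s * P * q) ^ k
            * (qpoch (- s * t / a) q (j - k) * qpoch (- s * t * q ^ k / (- s * P)) q (j - k)
                / (qpoch (- s * t * q ^ k) q (j - k) * qpoch (- s * t / (a * (- s * P))) q (j - k)))
       = ?G * (qpoch (inverse (q ^ j)) q k * qpoch a q k * q ^ k
               / (qpoch q q k * qpoch (- s) q k * qpoch (- s / t) q k) * R k)"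
      unfolding s1 s2 s3 s4 s5 e1 N_def[symmetric] power_mult_distrib[of "- s * P" q] R_def q_def[symmetric] P_def[symmetric]
      by (rule c[OF r3 n3 n5])
  qed
  finally have main: "(\<Sum>k\<le>j. qpoch (inverse (q ^ j)) q k * qpoch a q k
           * qpoch (- s * x) q k * qpoch (- s * y) q k
           / (qpoch q q k * qpoch (- s) q k * qpoch (- s * t) q k
              * qpoch (s^2 * P / t) q k) * q ^ k)
      = ?G * (\<Sum>k\<le>j. qpoch (inverse (q ^ j)) q k * qpoch a q k * q ^ k
               / (qpoch q q k * qpoch (- s) q k * qpoch (- s / t) q k) * R k)"
    by (simp only: sum_distrib_left)
  \<comment> \<open>As t^2 (-s/t) = -st, both sides are (-s/t;q)_(j+1), split at its last and at its
    first factor.\<close>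
  have ratio: "qpoch (- s / t) q j * (1 + s * q ^ j / t) = (1 + s / t) * qpoch (- s * t) q j"
  proof -
    have "qpoch (- s / t) q (Suc j) = (1 + s / t) * qpoch (- s * t) q j"
      unfolding qpoch_Suc_left using t by (simp add: q_def power2_eq_square mult.commute)
    then show ?thesis by (simp add: qpoch_Suc mult.commute[of "q ^ j" s])
  qed
  have fac: "1 - s^2 * q ^ (2 * j) / q = (1 - s * q ^ j / t) * (1 + s * q ^ j / t)"
    using t by (simp add: q_def power_mult field_simps power2_eq_square power_mult_distrib)
  let ?H = "P ^ j * qpoch (t / P) q j / qpoch (s^2 * P / t) q j * (1 - s * q ^ j / t) * (1 + s / t)
     * qpoch (s^2) q (j - 1) / qpoch q q j"
  have pre: "(-1) ^ j * inverse s ^ j * (qpoch (s^2) q (j - 1) / qpoch q q j)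
     * (1 - s^2 * q ^ (2 * j) / q) * ?G = ?H"
  proof -
    have 1: "(-1) ^ j * inverse s ^ j * (- s * P) ^ j = P ^ j"
      using nz by (simp add: power_mult_distrib[symmetric] mult.assoc[symmetric])
    have 2: "(-1) ^ j * inverse s ^ j * (qpoch (s^2) q (j - 1) / qpoch q q j)
     * (1 - s^2 * q ^ (2 * j) / q) * ?G = ((-1) ^ j * inverse s ^ j * (- s * P) ^ j) * (qpoch (s^2) q (j - 1) / qpoch q q j)
       * (1 - s * q ^ j / t) * (qpoch (- s / t) q j * (1 + s * q ^ j / t) / qpoch (- s * t) q j)
       * qpoch (t / P) q j / qpoch (s^2 * P / t) q j"
      unfolding fac by (simp add: mult_ac)
    have 3: "(1 + s / t) * qpoch (- s * t) q j / qpoch (- s * t) q j = 1 + s / t"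
      using n2[of j] by simp
    show ?thesis unfolding 2 1 ratio 3 by (simp add: mult_ac)
  qed
  have "B0 s j = (-1) ^ j * inverse s ^ j * (qpoch (s^2) q (j - 1) / qpoch q q j)
     * (1 - s^2 * q ^ (2 * j) / q) * (?G * (\<Sum>k\<le>j. qpoch (inverse (q ^ j)) q k * qpoch a q k * q ^ k
               / (qpoch q q k * qpoch (- s) q k * qpoch (- s / t) q k) * R k))"
    unfolding main[symmetric] using Suc by (simp add: B_red_def a_def q_def P_def)
  also have "\<dots> = ?H * (\<Sum>k\<le>j. qpoch (inverse (q ^ j)) q k * qpoch a q k * q ^ k
               / (qpoch q q k * qpoch (- s) q k * qpoch (- s / t) q k) * R k)"
    unfolding pre[symmetric] by (simp only: mult.assoc)
  also have "\<dots> = (\<Sum>k\<le>j. B_term s j k * R k)"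
    unfolding sum_distrib_left
  proof (rule sum.cong[OF refl])
    fix k
    \<comment> \<open>The parameter a = s^2 q^(j-1) continues the factorial of the prefactor; this
      uses j > 0.\<close>
    have "qpoch (s^2) q (j + k - 1) = qpoch (s^2) q (j - 1) * qpoch a q k"
      using qpoch_add[of "s^2" q "j - 1" k] nz Suc by (simp add: a_def mult_ac)
    then show "?H * (qpoch (inverse (q ^ j)) q k * qpoch a q k * q ^ k
               / (qpoch q q k * qpoch (- s) q k * qpoch (- s / t) q k) * R k) = B_term s j k * R k"
      using Suc by (simp add: B_term_def mult_ac q_def[symmetric] P_def[symmetric])
  qed
  finally show ?thesis .
qed

end

section \<open>The recurrence for B\<close>

text \<open>This is what remains of \<open>B_term_rec_core\<close> after dividing by the common
  factor of all terms, with s = tu, xy = tp, J = t^(2I), Q = t^(2K), multiplied by Q to clear the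
  last denominator.\<close>

lemma B_term_rec_polynomial:
  fixes u p t J Q :: "'a::comm_ring_1"
  shows "Q * (t * (p - t * t * J) * (1 - u * u * p) * (1 - u * (t * t) * (t * t) * J) * (1 - t * u * (t * u) * (t * t) * J * Q)
      + (1 - u * u * p) * (1 - t * t * (t * t) * J * (u * u * p)) * (1 - u * (t * t) * J) * (t * t * (Q - t * t * J))
      - t * (p - t * t * J) * (1 - t * t * (t * t) * J * (u * u * p)) * (1 - t * u * (t * t) * J) * (1 - u) * (1 + t * u * Q))
    = - (t * (u * p - 1)) * ((u * p + t * Q) * (1 - t * u * (t * t) * J) * (1 - t * u * (t * u) * (t * t) * J * Q) * (Q - t * t * J)
        + u * (p - Q) * (1 - t * u * (t * t) * J) * J * (t * t) * (1 - t * t * Q) * (1 + t * u * Q))"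
  by (simp add: algebra_simps)

context generic
begin

text \<open>The part of f(s) = F(s,0) that depends on x and y only through xy, as the coefficients
  \<open>B_term\<close> do.\<close>

definition F_outer :: "'k \<Rightarrow> 'k" where
  "F_outer s = (1 - 1 / s) * (1 - t^2 / (s * (x * y)))
         / ((1 - t / (s^2 * (x * y))) * (1 - t^3 / (s^2 * (x * y))))"

text \<open>These are the lower factorials of \<open>B_term\<close> at s, st and s/t; at n = 1 the
  last but one and its predecessor also control the denominators of \<open>F_outer\<close>.\<close>

lemma regular_nonzero:
  assumes "regular s"
  shows "s \<noteq> 0" "qpoch (- s) (t^2) n \<noteq> 0" "qpoch (- s * t) (t^2) n \<noteq> 0" "qpoch (- s / t) (t^2) n \<noteq> 0"
    "qpoch (- s / t / t) (t^2) n \<noteq> 0"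
    "qpoch (s^2 * (x * y) / t) (t^2) n \<noteq> 0" "qpoch (s^2 * (x * y) / t^3) (t^2) n \<noteq> 0"
    "qpoch (s^2 * (x * y) * t) (t^2) n \<noteq> 0"
proof -
  show "s \<noteq> 0" using assms by (simp add: regular_def)
  show "qpoch (- s) (t^2) n \<noteq> 0" using qpoch_minus_nonzero[OF assms, of 0 n] by simp
  show "qpoch (- s * t) (t^2) n \<noteq> 0" using qpoch_minus_nonzero[OF assms, of 1 n] by simp
  show "qpoch (- s / t) (t^2) n \<noteq> 0"
    using qpoch_minus_nonzero[OF assms, of "-1" n] by (simp add: divide_inverse power_int_minus)
  show "qpoch (- s / t / t) (t^2) n \<noteq> 0"
    using qpoch_minus_nonzero[OF assms, of "-2" n]
    by (simp add: divide_inverse power_int_minus power2_eq_square mult.assoc)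
  show "qpoch (s^2 * (x * y) / t) (t^2) n \<noteq> 0"
    using qpoch_odd_nonzero[OF assms, of "-1" n] by (simp add: divide_inverse power_int_minus)
  show "qpoch (s^2 * (x * y) / t^3) (t^2) n \<noteq> 0"
    using qpoch_odd_nonzero[OF assms, of "-3" n] by (simp add: divide_inverse power_int_minus)
  show "qpoch (s^2 * (x * y) * t) (t^2) n \<noteq> 0"
    using qpoch_odd_nonzero[OF assms, of 1 n] by simp
qed

text \<open>Over the common denominator of the recurrence, \<open>B_term (s * t)\<close> carries the
  factors (1 - w)(1 - t^2 w)(1 + s) with w = s^2xy/t^3. The first two cancel the denominators of
  \<open>F_outer\<close>; the third combines with 1 - 1/s to the factor 1 - s^2 that the other terms
  contain.\<close>

lemma F_outer_mult:
  assumes s: "regular s"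
  shows "F_outer s * ((1 - s^2 * (x * y) / t^3) * (1 - t * t * (s^2 * (x * y) / t^3)) * (1 + s))
     = - (s * (x * y) - t * t) * s^2 * (x * y) / t^4 * (1 - s * s)"
proof -
  define P where "P = x * y"
  define w where "w = s^2 * P / t^3"
  note nz0 = regular_nonzero[OF s, folded P_def]
  have nz: "s \<noteq> 0" "P \<noteq> 0" "t \<noteq> 0"
    using s x y t by (auto simp: regular_def P_def)
  have w1: "t * t * w = s^2 * P / t" using nz by (simp add: w_def power2_eq_square power3_eq_cube)
  have w_nz: "1 - w \<noteq> 0" "1 - s^2 * P / t \<noteq> 0"
    using nz0(6,7)[of 1] by (simp_all add: qpoch_Suc w_def)
  have e: "(1 - w) * (1 - t * t * w) = (1 - t / (s^2 * P)) * (1 - t^3 / (s^2 * P)) * (s^2 * P / t^3) * (s^2 * P / t)"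
  proof -
    have "1 - w = - (1 - t^3 / (s^2 * P)) * (s^2 * P / t^3)"
      using nz by (simp add: w_def field_simps)
    moreover have "1 - t * t * w = - (1 - t / (s^2 * P)) * (s^2 * P / t)"
      unfolding w1 using nz by (simp add: field_simps)
    ultimately show ?thesis by (simp only: mult_minus_left mult_minus_right minus_minus mult_ac)
  qed
  then have n: "1 - t / (s^2 * P) \<noteq> 0" "1 - t^3 / (s^2 * P) \<noteq> 0"
    using w_nz unfolding w1 by auto
  have c: "g / (d * d') * (d * d' * v * v' * z) = g * v * v' * z" if "d \<noteq> 0" "d' \<noteq> 0" for g d d' v v' z :: 'k
    using that by simp
  have "F_outer s * ((1 - w) * (1 - t * t * w) * (1 + s))
      = (1 - 1 / s) * (1 - t^2 / (s * P)) * (s^2 * P / t^3) * (s^2 * P / t) * (1 + s)"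
    unfolding F_outer_def P_def[symmetric] e by (rule c[OF n])
  also have "\<dots> = - (s * P - t * t) * s^2 * P / t^4 * (1 - s * s)"
    using nz by (simp add: divide_simps) (simp add: algebra_simps power2_eq_square power3_eq_cube power4_eq_xxxx)
  finally show ?thesis by (simp add: w_def P_def)
qed

text \<open>This compares the coefficients of \<open>R (K + 1)\<close> in the recurrence for B. Two
  terms appear on the right because the separate x, y factors of f turn \<open>R K\<close> partly
  into \<open>R (K + 1)\<close>. The index I + 1 keeps clear of the exceptional value of
  \<open>B_term\<close> at j = 0.\<close>

lemma B_term_rec_core:
  assumes s: "regular s"
  shows "B_term s (I + 2) (K + 1) + B_term s (I + 1) (K + 1) - B_term (s / t) (I + 2) (K + 1)
    = F_outer s * ((1 + t / (s * (t^2) ^ (K + 1))) * (1 + t * (t^2) ^ (K + 1) / (s * (x * y))) * B_term (s * t) (I + 1) (K + 1)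
       - t / (s * (t^2) ^ K) * (1 - t * (t^2) ^ K / (x * y)) * B_term (s * t) (I + 1) K)"
proof -
  define q where "q = t * t"
  have tq: "t^2 = q" by (simp add: q_def power2_eq_square)
  define P where "P = x * y"
  define J where "J = q ^ I"
  define Q where "Q = q ^ K"
  define w0 where "w0 = s^2 * P / t^3"
  note nz0 = regular_nonzero[OF s, unfolded tq, folded P_def]
  have nz: "s \<noteq> 0" "q \<noteq> 0" "P \<noteq> 0" "J \<noteq> 0" "Q \<noteq> 0" "t \<noteq> 0"
    using s x y t by (auto simp: regular_def q_def P_def J_def Q_def)
  have w1: "s^2 * P / t = q * w0" using t by (simp add: w0_def q_def power2_eq_square power3_eq_cube)
  have w0': "(s / t)^2 * P / t = w0" by (simp add: w0_def power2_eq_square power3_eq_cube)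
  have w2: "(s * t)^2 * P / t = q * (q * w0)"
    using t by (simp add: w0_def q_def power2_eq_square power3_eq_cube)
  define \<Pi> where "\<Pi> = P ^ (I + 1)"
  define \<tau> where "\<tau> = qpoch (t / P) q (I + 1)"
  \<comment> \<open>The lower factorials at s/t, s and st start at w0, q w0 and q^2 w0. All of them
    are stretches of the I + 3 factors of \<open>\<omega>\<close>. Likewise \<open>\<sigma>\<close>
    is the common part of the upper factorials starting at s^2/q, s^2 and q s^2.\<close>
  define \<omega> where "\<omega> = qpoch w0 q (I + 3)"
  define \<sigma> where "\<sigma> = qpoch (q * s^2) q (I + K)"
  define \<nu> where "\<nu> = qpoch (inverse (q ^ (I + 2))) q (K + 1)"
  define \<rho> where "\<rho> = qpoch q q (I + 1)"
  define \<kappa> where "\<kappa> = qpoch q q K"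
  define \<alpha> where "\<alpha> = qpoch (- s) q K"
  define \<beta> where "\<beta> = qpoch (- s / t) q (K + 1)"
  have \<omega>nz: "\<omega> \<noteq> 0" using nz0 by (simp add: \<omega>_def w0_def)
  have e\<Pi>: "P ^ (I + 2) = \<Pi> * P" by (simp add: \<Pi>_def)
  have e\<tau>: "qpoch (t / P) q (I + 2) = \<tau> * (1 - q * J * (t / P))"
    using qpoch_Suc[of "t / P" q "I + 1"] by (simp add: \<tau>_def J_def)
  have \<omega>1: "\<omega> = (1 - w0) * qpoch (q * w0) q (I + 2)"
    using qpoch_Suc_left[of w0 q "I + 2"] by (simp add: \<omega>_def numeral_3_eq_3)
  have \<omega>2: "qpoch (q * w0) q (I + 2) = qpoch (q * w0) q (I + 1) * (1 - q * q * J * w0)"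
    using qpoch_Suc[of "q * w0" q "I + 1"] by (simp add: J_def mult_ac)
  have \<omega>3: "\<omega> = qpoch w0 q (I + 2) * (1 - q * q * J * w0)"
    using qpoch_Suc[of w0 q "I + 2"] by (simp add: \<omega>_def numeral_3_eq_3 J_def mult_ac)
  have \<omega>4: "\<omega> = (1 - w0) * ((1 - q * w0) * qpoch (q * (q * w0)) q (I + 1))"
    using qpoch_Suc_left[of "q * w0" q "I + 1"] unfolding \<omega>1 by simp
  have inv: "1 / u = v / \<omega>" if "\<omega> = v * u" for u v
    using that \<omega>nz by auto
  have i1: "1 / qpoch (q * w0) q (I + 2) = (1 - w0) / \<omega>" by (rule inv[OF \<omega>1])
  have i2: "1 / qpoch (q * w0) q (I + 1) = (1 - w0) * (1 - q * q * J * w0) / \<omega>"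
    by (rule inv) (simp add: \<omega>1[unfolded \<omega>2])
  have i3: "1 / qpoch w0 q (I + 2) = (1 - q * q * J * w0) / \<omega>"
    by (rule inv) (simp add: \<omega>3)
  have i4: "1 / qpoch (q * (q * w0)) q (I + 1) = (1 - w0) * (1 - q * w0) / \<omega>"
    by (rule inv) (simp add: \<omega>4)
  have \<sigma>1: "qpoch (s^2) q (I + 2 + (K + 1) - 1) = (1 - s^2) * \<sigma> * (1 - s^2 * q * J * Q)"
    using qpoch_Suc[of "s^2" q "I + K + 1"] qpoch_Suc_left[of "s^2" q "I + K"]
    by (simp add: \<sigma>_def J_def Q_def power_add mult_ac)
  have \<sigma>2: "qpoch (s^2) q (I + 1 + (K + 1) - 1) = (1 - s^2) * \<sigma>"
    using qpoch_Suc_left[of "s^2" q "I + K"] by (simp add: \<sigma>_def)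
  have \<sigma>3: "qpoch ((s / t)^2) q (I + 2 + (K + 1) - 1) = (1 - s^2 / q) * (1 - s^2) * \<sigma>"
    using qpoch_Suc_left[of "s^2 / q" q "I + K + 1"] qpoch_Suc_left[of "s^2" q "I + K"] nz
    by (simp add: \<sigma>_def power_divide tq)
  have \<sigma>4: "qpoch ((s * t)^2) q (I + 1 + (K + 1) - 1) = \<sigma> * (1 - s^2 * q * J * Q)"
    using qpoch_Suc[of "q * s^2" q "I + K"]
    by (simp add: \<sigma>_def J_def Q_def power_add mult_ac power_mult_distrib tq)
  have \<sigma>5: "qpoch ((s * t)^2) q (I + 1 + K - 1) = \<sigma>"
    by (simp add: \<sigma>_def mult_ac power_mult_distrib tq)
  have q1: "1 - q * q * J \<noteq> 0"
    using t2_power[rule_format, of "I + 2"] by (simp add: tq J_def mult_ac)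
  have q2: "1 - q * Q \<noteq> 0" using t2_power[rule_format, of "K + 1"] by (simp add: tq Q_def)
  have q3: "1 - 1 / (q * q * J) \<noteq> 0" using q1 nz by (simp add: field_simps)
  have \<nu>1: "qpoch (inverse (q ^ (I + 1))) q K = \<nu> / (1 - 1 / (q * q * J))"
    using qpoch_Suc_left[of "inverse (q ^ (I + 2))" q K] q3 nz
    by (simp add: \<nu>_def J_def field_simps)
  have \<nu>2: "qpoch (inverse (q ^ (I + 1))) q (K + 1) = \<nu> * (1 - Q / (q * J)) / (1 - 1 / (q * q * J))"
    using qpoch_Suc[of "inverse (q ^ (I + 1))" q K, unfolded \<nu>1]
    by (simp add: Q_def J_def divide_inverse mult_ac)
  have \<rho>1: "qpoch q q (I + 2) = \<rho> * (1 - q * q * J)"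
    using qpoch_Suc[of q q "I + 1"] by (simp add: \<rho>_def J_def mult_ac)
  have \<kappa>1: "qpoch q q (K + 1) = \<kappa> * (1 - q * Q)"
    using qpoch_Suc[of q q K] by (simp add: \<kappa>_def Q_def mult_ac)
  have \<alpha>1: "qpoch (- s) q (K + 1) = \<alpha> * (1 + s * Q)"
    using qpoch_Suc[of "- s" q K] by (simp add: \<alpha>_def Q_def mult_ac)
  have \<alpha>2: "qpoch (- (s / t) / t) q (K + 1) = (1 + s / q) * \<alpha>"
    using qpoch_Suc_left[of "- s / t / t" q K] nz by (simp add: \<alpha>_def q_def)
  have \<beta>0: "(1 + s / t) * qpoch (- (s * t)) q n = qpoch (- s / t) q (n + 1)" for n
    using qpoch_Suc_left[of "- s / t" q n] nz by (simp add: q_def mult_ac)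
  have s1: "1 + s / t \<noteq> 0" using nz0(4)[of 1] by (simp add: qpoch_Suc)
  have s2: "1 + s * Q \<noteq> 0" using nz0(2)[of "K + 1"] \<alpha>1 by auto
  have \<beta>3: "qpoch (- (s * t)) q K = \<beta> / (1 + s / t)"
    using \<beta>0[of K] s1 by (simp add: \<beta>_def field_simps)
  have \<beta>2: "qpoch (- (s * t)) q (K + 1) = \<beta> * (1 + s * t * Q) / (1 + s / t)"
    using qpoch_Suc[of "- (s * t)" q K] unfolding \<beta>3 by (simp add: Q_def mult_ac)
  have s3: "1 + s * t * Q \<noteq> 0" using nz0(3)[of "K + 1"] \<beta>2 by auto
  have s4: "1 + s / q \<noteq> 0" using nz0(5)[of "K + 1"] \<alpha>2 by auto
  \<comment> \<open>The common factor of all five terms. \<open>B_term (s * t)\<close> lacks the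
    factor 1 - s^2; \<open>F_outer\<close> supplies it through fact \<open>g\<close>.\<close>
  define Y where "Y = \<Pi> * \<tau> * \<sigma> * \<nu> * (q * Q) * (1 + s / t) * (1 - s^2)
       / (\<omega> * \<rho> * \<kappa> * \<alpha> * \<beta> * (1 - q * q * J) * (1 - q * Q) * (1 + s * Q))"
  have b1: "B_term s (I + 2) (K + 1) = Y * (P * (1 - q * J * (t / P)) * (1 - w0) * (1 - s * q * q * J / t) * (1 - s^2 * q * J * Q))"
  proof -
    have "B_term s (I + 2) (K + 1) = P ^ (I + 2) * qpoch (t / P) q (I + 2) * (1 / qpoch (q * w0) q (I + 2))
     * (1 - s * q ^ (I + 2) / t) * (1 + s / t)
     * qpoch (s^2) q (I + 2 + (K + 1) - 1) * \<nu> * q ^ (K + 1)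
     / (qpoch q q (I + 2) * qpoch q q (K + 1) * qpoch (- s) q (K + 1) * \<beta>)"
      by (simp add: B_term_def tq \<nu>_def \<beta>_def w1 flip: P_def)
    also have "\<dots> = Y * (P * (1 - q * J * (t / P)) * (1 - w0) * (1 - s * q * q * J / t) * (1 - s^2 * q * J * Q))"
      unfolding e\<Pi> e\<tau> i1 \<sigma>1 \<rho>1 \<kappa>1 \<alpha>1 Y_def
      by (simp add: J_def Q_def power_add power2_eq_square mult_ac)
    finally show ?thesis .
  qed
  have b2: "B_term s (I + 1) (K + 1) = Y * ((1 - w0) * (1 - q * q * J * w0) * (1 - s * q * J / t) * (q * (Q - q * J)))"
  proof -
    have "B_term s (I + 1) (K + 1) = \<Pi> * \<tau> * (1 / qpoch (q * w0) q (I + 1))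
     * (1 - s * q ^ (I + 1) / t) * (1 + s / t)
     * qpoch (s^2) q (I + 1 + (K + 1) - 1) * qpoch (inverse (q ^ (I + 1))) q (K + 1) * q ^ (K + 1)
     / (\<rho> * qpoch q q (K + 1) * qpoch (- s) q (K + 1) * \<beta>)"
      by (simp add: B_term_def tq \<Pi>_def \<tau>_def \<rho>_def \<beta>_def w1 flip: P_def)
    also have "\<dots> = (\<Pi> * \<tau> * \<sigma> * \<nu> * (q * Q) * (1 + s / t) * (1 - s^2)
       / (\<omega> * \<rho> * \<kappa> * \<alpha> * \<beta> * (1 - q * Q) * (1 + s * Q))) * ((1 - w0) * (1 - q * q * J * w0) * (1 - s * q * J / t))
         * ((1 - Q / (q * J)) / (1 - 1 / (q * q * J)))"
      unfolding i2 \<sigma>2 \<nu>2 \<kappa>1 \<alpha>1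
      by (simp add: J_def Q_def power_add power2_eq_square mult_ac)
    also have "(1 - Q / (q * J)) / (1 - 1 / (q * q * J)) = q * (Q - q * J) / (1 - q * q * J)"
      using q1 q3 nz by (simp add: divide_simps) (simp add: algebra_simps)
    finally show ?thesis unfolding Y_def by (simp add: mult_ac)
  qed
  have b3: "B_term (s / t) (I + 2) (K + 1) = Y * (P * (1 - q * J * (t / P)) * (1 - q * q * J * w0)
      * (1 - s * q * q * J / q) * (1 - s / t) * (1 + s * Q))"
  proof -
    have "B_term (s / t) (I + 2) (K + 1) = P ^ (I + 2) * qpoch (t / P) q (I + 2) * (1 / qpoch w0 q (I + 2))
     * (1 - s / t * q ^ (I + 2) / t) * (1 + s / t / t)
     * qpoch ((s / t)^2) q (I + 2 + (K + 1) - 1) * \<nu> * q ^ (K + 1)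
     / (qpoch q q (I + 2) * qpoch q q (K + 1) * \<beta> * qpoch (- (s / t) / t) q (K + 1))"
      by (simp add: B_term_def tq \<nu>_def \<beta>_def w0' flip: P_def)
    also have "\<dots> = \<Pi> * P * (\<tau> * (1 - q * J * (t / P))) * ((1 - q * q * J * w0) / \<omega>)
        * (1 - s * q * q * J / q) * (1 + s / q) * ((1 - s / t) * (1 + s / t) * (1 - s^2) * \<sigma>) * \<nu> * (q * Q)
       / (\<rho> * (1 - q * q * J) * (\<kappa> * (1 - q * Q)) * \<beta> * ((1 + s / q) * \<alpha>))"
    proof -
      have *: "1 - s^2 / q = (1 - s / t) * (1 + s / t)"
        using nz by (simp add: q_def field_simps power2_eq_square)
      have **: "1 - s / t * q ^ (I + 2) / t = 1 - s * q * q * J / q" "1 + s / t / t = 1 + s / q"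
        using nz by (simp_all add: q_def J_def power_add power2_eq_square)
      show ?thesis
        unfolding e\<Pi> e\<tau> i3 \<sigma>3 \<rho>1 \<kappa>1 \<alpha>2 * ** by (simp add: Q_def)
    qed
    also have "\<dots> = Y * (P * (1 - q * J * (t / P)) * (1 - q * q * J * w0) * (1 - s * q * q * J / q) * (1 - s / t) * (1 + s * Q))"
      unfolding Y_def using s4 s2 by (simp add: mult_ac)
    finally show ?thesis .
  qed
  define \<gamma> where "\<gamma> = - (s * P - q) * s^2 * P / t^4"
  have g: "F_outer s * ((1 - w0) * (1 - q * w0) * (1 + s)) = \<gamma> * (1 - s^2)"
    using F_outer_mult[OF s] by (simp add: \<gamma>_def w0_def q_def P_def power2_eq_square)
  have b4: "F_outer s * ((1 + t / (s * (q * Q))) * B_term (s * t) (I + 1) (K + 1))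
     = Y * (\<gamma> * t / (s * Q) * (1 - s * q * J) * (1 - s^2 * q * J * Q) * (Q - q * J))"
  proof -
    have "B_term (s * t) (I + 1) (K + 1) = \<Pi> * \<tau> * (1 / qpoch (q * (q * w0)) q (I + 1))
     * (1 - s * q ^ (I + 1)) * (1 + s)
     * qpoch ((s * t)^2) q (I + 1 + (K + 1) - 1) * qpoch (inverse (q ^ (I + 1))) q (K + 1) * q ^ (K + 1)
     / (\<rho> * qpoch q q (K + 1) * qpoch (- (s * t)) q (K + 1) * qpoch (- s) q (K + 1))"
      using nz by (simp add: B_term_def tq \<Pi>_def \<tau>_def \<rho>_def \<beta>_def w2 flip: P_def)
    also have "\<dots> = (\<Pi> * \<tau> * \<sigma> * \<nu> * (q * Q) * (1 + s / t)
       / (\<omega> * \<rho> * \<kappa> * \<alpha> * \<beta> * (1 - q * Q) * (1 + s * Q))) * ((1 - w0) * (1 - q * w0) * (1 + s))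
         * ((1 - s * q * J) * (1 - s^2 * q * J * Q) / (1 + s * t * Q))
         * ((1 - Q / (q * J)) / (1 - 1 / (q * q * J)))"
      unfolding i4 \<sigma>4 \<nu>2 \<kappa>1 \<alpha>1 \<beta>2
      by (simp add: J_def Q_def mult_ac)
    also have "(1 - Q / (q * J)) / (1 - 1 / (q * q * J)) = q * (Q - q * J) / (1 - q * q * J)"
      using q1 q3 nz by (simp add: divide_simps) (simp add: algebra_simps)
    finally have *: "B_term (s * t) (I + 1) (K + 1) = (\<Pi> * \<tau> * \<sigma> * \<nu> * (q * Q) * (1 + s / t)
       / (\<omega> * \<rho> * \<kappa> * \<alpha> * \<beta> * (1 - q * Q) * (1 + s * Q))) * ((1 - w0) * (1 - q * w0) * (1 + s))
         * ((1 - s * q * J) * (1 - s^2 * q * J * Q) / (1 + s * t * Q))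
         * (q * (Q - q * J) / (1 - q * q * J))" .
    have **: "1 + t / (s * (q * Q)) = t / (s * q * Q) * (1 + s * t * Q)"
      using nz by (simp add: q_def field_simps)
    have "F_outer s * ((1 + t / (s * (q * Q))) * B_term (s * t) (I + 1) (K + 1))
      = (\<Pi> * \<tau> * \<sigma> * \<nu> * (q * Q) * (1 + s / t)
       / (\<omega> * \<rho> * \<kappa> * \<alpha> * \<beta> * (1 - q * Q) * (1 + s * Q))) * (F_outer s * ((1 - w0) * (1 - q * w0) * (1 + s)))
         * (t / (s * q * Q) * (1 + s * t * Q) * ((1 - s * q * J) * (1 - s^2 * q * J * Q) / (1 + s * t * Q)))
         * (q * (Q - q * J) / (1 - q * q * J))"
      unfolding * ** by (simp only: mult_ac)
    also have "\<dots> = Y * (\<gamma> * t / (s * Q) * (1 - s * q * J) * (1 - s^2 * q * J * Q) * (Q - q * J))"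
      unfolding g Y_def using s3 nz by (simp add: mult_ac)
    finally show ?thesis .
  qed
  have b5: "F_outer s * B_term (s * t) (I + 1) K
     = - Y * (\<gamma> * (1 - s * q * J) * J * q * (1 - q * Q) * (1 + s * Q))"
  proof -
    have "B_term (s * t) (I + 1) K = \<Pi> * \<tau> * (1 / qpoch (q * (q * w0)) q (I + 1))
     * (1 - s * q ^ (I + 1)) * (1 + s)
     * qpoch ((s * t)^2) q (I + 1 + K - 1) * qpoch (inverse (q ^ (I + 1))) q K * q ^ K
     / (\<rho> * \<kappa> * qpoch (- (s * t)) q K * \<alpha>)"
      using nz by (simp add: B_term_def tq \<Pi>_def \<tau>_def \<rho>_def \<kappa>_def \<alpha>_def w2 flip: P_def)
    also have "\<dots> = (\<Pi> * \<tau> * \<sigma> * \<nu> * Q * (1 + s / t) / (\<omega> * \<rho> * \<kappa> * \<alpha> * \<beta>))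
         * ((1 - w0) * (1 - q * w0) * (1 + s)) * (1 - s * q * J) * (1 / (1 - 1 / (q * q * J)))"
      unfolding i4 \<sigma>5 \<nu>1 \<beta>3
      by (simp add: J_def Q_def mult_ac)
    also have "1 / (1 - 1 / (q * q * J)) = - (q * q * J) / (1 - q * q * J)"
      using q1 q3 nz by (simp add: divide_simps) (simp add: algebra_simps)
    finally have *: "B_term (s * t) (I + 1) K = (\<Pi> * \<tau> * \<sigma> * \<nu> * Q * (1 + s / t) / (\<omega> * \<rho> * \<kappa> * \<alpha> * \<beta>))
         * ((1 - w0) * (1 - q * w0) * (1 + s)) * (1 - s * q * J) * (- (q * q * J) / (1 - q * q * J))" .
    have "F_outer s * B_term (s * t) (I + 1) K = (\<Pi> * \<tau> * \<sigma> * \<nu> * Q * (1 + s / t) / (\<omega> * \<rho> * \<kappa> * \<alpha> * \<beta>))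
         * (F_outer s * ((1 - w0) * (1 - q * w0) * (1 + s))) * (1 - s * q * J) * (- (q * q * J) / (1 - q * q * J))"
      unfolding * by (simp only: mult_ac)
    also have "\<dots> = - Y * (\<gamma> * (1 - s * q * J) * J * q * (1 - q * Q) * (1 + s * Q))"
      unfolding g Y_def using q2 s2 nz by (simp add: mult_ac)
    finally show ?thesis .
  qed
  have key: "P * (1 - q * J * (t / P)) * (1 - w0) * (1 - s * q * q * J / t) * (1 - s^2 * q * J * Q)
      + (1 - w0) * (1 - q * q * J * w0) * (1 - s * q * J / t) * (q * (Q - q * J))
      - P * (1 - q * J * (t / P)) * (1 - q * q * J * w0) * (1 - s * q * q * J / q) * (1 - s / t) * (1 + s * Q)
      = (1 + t * (q * Q) / (s * P)) * (\<gamma> * t / (s * Q) * (1 - s * q * J) * (1 - s^2 * q * J * Q) * (Q - q * J))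
        + t / (s * Q) * (1 - t * Q / P) * (\<gamma> * (1 - s * q * J) * J * q * (1 - q * Q) * (1 + s * Q))"
  proof -
    \<comment> \<open>With s = tu and xy = tp one has w0 = u^2 p, and the powers of t in the
      denominators disappear. The remaining denominators s and xy are cancelled by
      \<open>\<gamma>\<close>, and Q by multiplying with it.\<close>
    define u p where "u = s / t" and "p = P / t"
    have su: "s = t * u" and Pp: "P = t * p" using nz by (simp_all add: u_def p_def)
    have unz: "u \<noteq> 0" "p \<noteq> 0" using nz by (simp_all add: u_def p_def)
    have h: "P * (1 - q * J * (t / P)) = t * (p - t * t * J)" "w0 = u * u * p" "s / t = u"
      "s * q * q * J / t = u * (t * t) * (t * t) * J" "s^2 * q * J * Q = t * u * (t * u) * (t * t) * J * Q"
      "s * q * J / t = u * (t * t) * J" "s * q * q * J / q = t * u * (t * t) * J" "s * q * J = t * u * (t * t) * J"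
      "t * u * (t * t) * J / t = u * (t * t) * J"
      using nz unz by (simp_all add: su Pp w0_def q_def field_simps power2_eq_square power3_eq_cube)
    have \<gamma>1: "Q * ((1 + t * (q * Q) / (s * P)) * (\<gamma> * t / (s * Q) * A)) = - (t * (u * p - 1)) * ((u * p + t * Q) * A)" for A
      unfolding \<gamma>_def su Pp q_def using nz unz
      by (simp add: divide_simps) (simp add: algebra_simps power2_eq_square power4_eq_xxxx)
    have \<gamma>2: "Q * (t / (s * Q) * (1 - t * Q / P) * (\<gamma> * A)) = - (t * (u * p - 1)) * (u * (p - Q) * A)" for A
      unfolding \<gamma>_def su Pp q_def using nz unz
      by (simp add: divide_simps) (simp add: algebra_simps power2_eq_square power4_eq_xxxx)
    have "Q * (P * (1 - q * J * (t / P)) * (1 - w0) * (1 - s * q * q * J / t) * (1 - s^2 * q * J * Q)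
      + (1 - w0) * (1 - q * q * J * w0) * (1 - s * q * J / t) * (q * (Q - q * J))
      - P * (1 - q * J * (t / P)) * (1 - q * q * J * w0) * (1 - s * q * q * J / q) * (1 - s / t) * (1 + s * Q))
     = Q * ((1 + t * (q * Q) / (s * P)) * (\<gamma> * t / (s * Q) * ((1 - s * q * J) * (1 - s^2 * q * J * Q) * (Q - q * J)))
        + t / (s * Q) * (1 - t * Q / P) * (\<gamma> * ((1 - s * q * J) * J * q * (1 - q * Q) * (1 + s * Q))))"
      unfolding distrib_left[of Q "(1 + t * (q * Q) / (s * P)) * _"] \<gamma>1 \<gamma>2 distrib_left[of "- (t * (u * p - 1))", symmetric]
      unfolding h unfolding q_def su using B_term_rec_polynomial[of Q t p J u] by (simp only: mult.assoc)
    then show ?thesis using nz(5) by (simp only: mult.assoc mult_cancel_left) simp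
  qed
  have "B_term s (I + 2) (K + 1) + B_term s (I + 1) (K + 1) - B_term (s / t) (I + 2) (K + 1)
    = Y * (P * (1 - q * J * (t / P)) * (1 - w0) * (1 - s * q * q * J / t) * (1 - s^2 * q * J * Q)
      + (1 - w0) * (1 - q * q * J * w0) * (1 - s * q * J / t) * (q * (Q - q * J))
      - P * (1 - q * J * (t / P)) * (1 - q * q * J * w0) * (1 - s * q * q * J / q) * (1 - s / t) * (1 + s * Q))"
    unfolding b1 b2 b3 by (simp only: distrib_left right_diff_distrib)
  also have "\<dots> = (1 + t * (q * Q) / (s * P)) * (F_outer s * ((1 + t / (s * (q * Q))) * B_term (s * t) (I + 1) (K + 1)))
       - t / (s * Q) * (1 - t * Q / P) * (F_outer s * B_term (s * t) (I + 1) K)"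
  proof -
    have c: "Z * (A * r + B * r') = A * (Z * r) - B * (- Z * r')" for Z A B r r' :: 'k
      by (simp add: algebra_simps)
    show ?thesis unfolding key b4 b5 by (rule c)
  qed
  finally show ?thesis
    by (simp add: tq Q_def right_diff_distrib mult_ac flip: P_def)
qed

text \<open>At k = 0 there is no contribution from index k - 1 and all factorials of length k are
  empty, so a shorter common factor and a smaller polynomial identity suffice.\<close>

lemma B_term_rec_core_0:
  assumes s: "regular s"
  shows "B_term s (I + 2) 0 + B_term s (I + 1) 0 - B_term (s / t) (I + 2) 0
    = F_outer s * ((1 + t / s) * (1 + t / (s * (x * y))) * B_term (s * t) (I + 1) 0)"
proof -
  define q where "q = t * t"
  have tq: "t^2 = q" by (simp add: q_def power2_eq_square)
  define P where "P = x * y"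
  define J where "J = q ^ I"
  define u p where "u = s / t" and "p = P / t"
  define w where "w = u * u * p"
  note nz0 = regular_nonzero[OF s, unfolded tq, folded P_def]
  have nz: "s \<noteq> 0" "q \<noteq> 0" "P \<noteq> 0" "J \<noteq> 0" "t \<noteq> 0" "u \<noteq> 0" "p \<noteq> 0"
    using s x y t by (auto simp: regular_def q_def P_def J_def u_def p_def)
  have su: "s = t * u" and Pp: "P = t * p" using nz by (simp_all add: u_def p_def)
  have w1: "s^2 * P / t = q * w" using nz by (simp add: w_def q_def su Pp power2_eq_square)
  have w0: "s^2 * P / t^3 = w" using nz by (simp add: w_def q_def su Pp power2_eq_square power3_eq_cube)
  have w0': "(s / t)^2 * P / t = w" using nz by (simp add: w_def su Pp power2_eq_square)
  have w2: "(s * t)^2 * P / t = q * (q * w)"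
    using nz by (simp add: w_def q_def su Pp power2_eq_square)
  define \<Pi> where "\<Pi> = P ^ (I + 1)"
  define \<tau> where "\<tau> = qpoch (t / P) q (I + 1)"
  define \<omega> where "\<omega> = qpoch w q (I + 3)"
  define \<sigma> where "\<sigma> = qpoch (s^2) q I"
  define \<rho> where "\<rho> = qpoch q q (I + 1)"
  have \<omega>nz: "\<omega> \<noteq> 0" using nz0(7) by (simp add: \<omega>_def w0)
  have e\<tau>: "P ^ (I + 2) * qpoch (t / P) q (I + 2) = \<Pi> * \<tau> * (t * (p - t * t * J))"
    using qpoch_Suc[of "t / P" q "I + 1"] nz
    by (simp add: \<Pi>_def \<tau>_def J_def Pp q_def) (simp add: field_simps)
  have \<omega>1: "\<omega> = (1 - w) * qpoch (q * w) q (I + 2)"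
    using qpoch_Suc_left[of w q "I + 2"] by (simp add: \<omega>_def numeral_3_eq_3)
  have \<omega>2: "qpoch (q * w) q (I + 2) = qpoch (q * w) q (I + 1) * (1 - q * q * J * w)"
    using qpoch_Suc[of "q * w" q "I + 1"] by (simp add: J_def mult_ac)
  have \<omega>3: "\<omega> = qpoch w q (I + 2) * (1 - q * q * J * w)"
    using qpoch_Suc[of w q "I + 2"] by (simp add: \<omega>_def numeral_3_eq_3 J_def mult_ac)
  have \<omega>4: "\<omega> = (1 - w) * ((1 - q * w) * qpoch (q * (q * w)) q (I + 1))"
    using qpoch_Suc_left[of "q * w" q "I + 1"] unfolding \<omega>1 by simp
  have inv: "1 / d = v / \<omega>" if "\<omega> = v * d" for d v
    using that \<omega>nz by auto
  have i1: "1 / qpoch (q * w) q (I + 2) = (1 - w) / \<omega>" by (rule inv[OF \<omega>1])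
  have i2: "1 / qpoch (q * w) q (I + 1) = (1 - w) * (1 - q * q * J * w) / \<omega>"
    by (rule inv) (simp add: \<omega>1[unfolded \<omega>2])
  have i3: "1 / qpoch w q (I + 2) = (1 - q * q * J * w) / \<omega>"
    by (rule inv) (simp add: \<omega>3)
  have i4: "1 / qpoch (q * (q * w)) q (I + 1) = (1 - w) * (1 - q * w) / \<omega>"
    by (rule inv) (simp add: \<omega>4)
  have \<sigma>1: "qpoch (s^2) q (I + 1) = \<sigma> * (1 - s * s * J)"
    using qpoch_Suc[of "s^2" q I] by (simp add: \<sigma>_def J_def power2_eq_square mult_ac)
  have \<sigma>2: "(1 - s * s) * qpoch ((s * t)^2) q I = \<sigma> * (1 - s * s * J)"
    using qpoch_Suc_left[of "s^2" q I] \<sigma>1 by (simp add: power2_eq_square q_def mult_ac)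
  have \<sigma>3: "qpoch ((s / t)^2) q (I + 1) = (1 - u * u) * \<sigma>"
    using qpoch_Suc_left[of "(s / t)^2" q I] nz by (simp add: \<sigma>_def q_def power2_eq_square u_def)
  have q1: "1 - q * q * J \<noteq> 0"
    using t2_power[rule_format, of "I + 2"] by (simp add: tq J_def mult_ac)
  have \<rho>1: "qpoch q q (I + 2) = \<rho> * (1 - q * q * J)"
    using qpoch_Suc[of q q "I + 1"] by (simp add: \<rho>_def J_def mult_ac)
  define Y where "Y = \<Pi> * \<tau> * \<sigma> * (1 + u) / (\<omega> * \<rho> * (1 - q * q * J))"
  have b1: "B_term s (I + 2) 0 = Y * (t * (p - t * t * J) * (1 - w) * (1 - u * q * q * J) * (1 - s * s * J))"
  proof -
    have "B_term s (I + 2) 0 = (P ^ (I + 2) * qpoch (t / P) q (I + 2)) * (1 / qpoch (q * w) q (I + 2))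
        * (1 - s / t * q ^ (I + 2)) * (1 + s / t) * qpoch (s^2) q (I + 1) / qpoch q q (I + 2)"
      by (simp add: B_term_def tq w1 flip: P_def)
    also have "\<dots> = Y * (t * (p - t * t * J) * (1 - w) * (1 - u * q * q * J) * (1 - s * s * J))"
      unfolding e\<tau> i1 \<sigma>1 \<rho>1 Y_def u_def[symmetric] by (simp add: J_def mult_ac)
    finally show ?thesis .
  qed
  have b2: "B_term s (I + 1) 0 = Y * ((1 - w) * (1 - q * q * J * w) * (1 - u * q * J) * (1 - q * q * J))"
  proof -
    have "B_term s (I + 1) 0 = \<Pi> * \<tau> * (1 / qpoch (q * w) q (I + 1))
        * (1 - s / t * q ^ (I + 1)) * (1 + s / t) * \<sigma> / \<rho>"
      by (simp add: B_term_def tq w1 \<Pi>_def \<tau>_def \<sigma>_def \<rho>_def flip: P_def)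
    also have "\<dots> = Y * ((1 - w) * (1 - q * q * J * w) * (1 - u * q * J) * (1 - q * q * J))"
      unfolding i2 Y_def u_def[symmetric] using q1 by (simp add: J_def mult_ac)
    finally show ?thesis .
  qed
  have b3: "B_term (s / t) (I + 2) 0 = Y * ((p - t * t * J) * (1 - q * q * J * w) * (1 - s * q * J) * (t + u) * (1 - u))"
  proof -
    have "B_term (s / t) (I + 2) 0 = (P ^ (I + 2) * qpoch (t / P) q (I + 2)) * (1 / qpoch w q (I + 2))
        * (1 - s / t / t * q ^ (I + 2)) * (1 + u / t) * qpoch ((s / t)^2) q (I + 1) / qpoch q q (I + 2)"
      by (simp add: B_term_def tq w0' u_def flip: P_def)
    also have "\<dots> = \<Pi> * \<tau> * (t * (p - t * t * J)) * ((1 - q * q * J * w) / \<omega>)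
        * (1 - s * q * J) * ((t + u) / t) * ((1 - u) * (1 + u) * \<sigma>) / (\<rho> * (1 - q * q * J))"
    proof -
      have "1 - s / t / t * q ^ (I + 2) = 1 - s * q * J" using nz by (simp add: q_def J_def)
      moreover have "1 + u / t = (t + u) / t" using nz by (simp add: field_simps)
      moreover have "1 - u * u = (1 - u) * (1 + u)" by (simp add: algebra_simps)
      ultimately show ?thesis unfolding e\<tau> i3 \<sigma>3 \<rho>1 by simp
    qed
    also have "\<dots> = Y * ((p - t * t * J) * (1 - q * q * J * w) * (1 - s * q * J) * (t + u) * (1 - u))"
      unfolding Y_def using nz by (simp add: mult_ac)
    finally show ?thesis .
  qed
  define \<gamma> where "\<gamma> = - (s * P - q) * s^2 * P / t^4"
  have g: "F_outer s * ((1 - w) * (1 - q * w) * (1 + s)) = \<gamma> * (1 - s * s)"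
    using F_outer_mult[OF s] by (simp add: \<gamma>_def w0[symmetric] q_def P_def)
  have b4: "F_outer s * ((1 + t / s) * B_term (s * t) (I + 1) 0)
      = Y * (\<gamma> / u * (1 - s * q * J) * (1 - s * s * J) * (1 - q * q * J))"
  proof -
    have "B_term (s * t) (I + 1) 0 = \<Pi> * \<tau> * (1 / qpoch (q * (q * w)) q (I + 1))
     * (1 - s * q ^ (I + 1)) * (1 + s) * qpoch ((s * t)^2) q I / \<rho>"
      using nz by (simp add: B_term_def tq \<Pi>_def \<tau>_def \<rho>_def w2 flip: P_def)
    also have "\<dots> = \<Pi> * \<tau> / (\<omega> * \<rho>) * ((1 - w) * (1 - q * w) * (1 + s)) * (1 - s * q * J) * qpoch ((s * t)^2) q I"
      unfolding i4 by (simp add: J_def mult_ac)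
    finally have *: "B_term (s * t) (I + 1) 0 = \<Pi> * \<tau> / (\<omega> * \<rho>) * ((1 - w) * (1 - q * w) * (1 + s)) * (1 - s * q * J) * qpoch ((s * t)^2) q I" .
    have "1 + t / s = (1 + u) / u" using nz by (simp add: su field_simps)
    then have "F_outer s * ((1 + t / s) * B_term (s * t) (I + 1) 0) = \<Pi> * \<tau> / (\<omega> * \<rho>) * (F_outer s * ((1 - w) * (1 - q * w) * (1 + s))) * (1 - s * q * J)
        * ((1 + u) / u) * qpoch ((s * t)^2) q I"
      unfolding * by (simp only: mult_ac)
    also have "\<dots> = \<Pi> * \<tau> / (\<omega> * \<rho>) * \<gamma> * (1 - s * q * J) * ((1 + u) / u) * ((1 - s * s) * qpoch ((s * t)^2) q I)"
      unfolding g by (simp only: mult_ac)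
    also have "\<dots> = Y * (\<gamma> / u * (1 - s * q * J) * (1 - s * s * J) * (1 - q * q * J))"
      unfolding \<sigma>2 Y_def using q1 by (simp add: mult_ac)
    finally show ?thesis .
  qed
  have \<gamma>': "(1 + t / (s * P)) * (\<gamma> / u * A) = - (u * p - 1) * (t * u * p + 1) * A" for A
    unfolding \<gamma>_def su Pp q_def using nz
    by (simp add: divide_simps) (simp add: algebra_simps power2_eq_square power4_eq_xxxx)
  have key: "t * (p - t * t * J) * (1 - w) * (1 - u * q * q * J) * (1 - s * s * J)
     + (1 - w) * (1 - q * q * J * w) * (1 - u * q * J) * (1 - q * q * J)
     - (p - t * t * J) * (1 - q * q * J * w) * (1 - s * q * J) * (t + u) * (1 - u)
     = - (u * p - 1) * (t * u * p + 1) * ((1 - s * q * J) * (1 - s * s * J) * (1 - q * q * J))"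
    unfolding w_def q_def su by (simp add: algebra_simps)
  have "B_term s (I + 2) 0 + B_term s (I + 1) 0 - B_term (s / t) (I + 2) 0
    = Y * (t * (p - t * t * J) * (1 - w) * (1 - u * q * q * J) * (1 - s * s * J)
     + (1 - w) * (1 - q * q * J * w) * (1 - u * q * J) * (1 - q * q * J)
     - (p - t * t * J) * (1 - q * q * J * w) * (1 - s * q * J) * (t + u) * (1 - u))"
    unfolding b1 b2 b3 by (simp only: distrib_left right_diff_distrib)
  also have "\<dots> = (1 + t / (s * P)) * (F_outer s * ((1 + t / s) * B_term (s * t) (I + 1) 0))"
    unfolding key b4 \<gamma>'[symmetric] by (simp only: mult_ac)
  finally show ?thesis by (simp add: mult_ac flip: P_def)
qed

lemma B_term_eq_0: "j < k \<Longrightarrow> B_term s j k = 0"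
  using t qpoch_inverse_power_eq_0[of "t^2" j k] by (auto simp: B_term_def)

lemma F_outer_alt:
  assumes "regular s"
  shows "F_outer s = (s - 1) * (s * (x * y) - t * t) * (s * s * (x * y))
     / ((s * s * (x * y) - t) * (s * s * (x * y) - t * t * t))"
proof -
  have nz: "s \<noteq> 0" "x * y \<noteq> 0" using assms x y by (auto simp: regular_def)
  have *: "1 - 1 / s = (s - 1) / s" "1 - t^2 / (s * (x * y)) = (s * (x * y) - t * t) / (s * (x * y))"
    "1 - t / (s^2 * (x * y)) = (s * s * (x * y) - t) / (s * s * (x * y))"
    "1 - t^3 / (s^2 * (x * y)) = (s * s * (x * y) - t * t * t) / (s * s * (x * y))"
    using nz by (simp_all add: diff_divide_distrib power2_eq_square power3_eq_cube)
  show ?thesis unfolding F_outer_def * using nz by simp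
qed

text \<open>For j = 0 the recurrence involves only \<open>B_term\<close> with first index 1 and the
  exceptional value at index 0. These closed forms reduce that case to polynomial
  identities.\<close>

lemma B_term_1:
  assumes "regular s"
  shows "B_term s 1 0 = (x * y - t) * (1 - s * t) * (t + s) / ((t - s * s * (x * y)) * (1 - t * t))"
    and "B_term s 1 1 = - ((x * y - t) * (1 - s * t) * (1 - s) * t) / ((t - s * s * (x * y)) * (1 - t * t))"
proof -
  define P where "P = x * y"
  have nz: "P \<noteq> 0" "t \<noteq> 0" "s \<noteq> 0" using x y t assms by (auto simp: P_def regular_def)
  have nz1: "1 + s / t \<noteq> 0" "1 + s \<noteq> 0" "1 - t * t \<noteq> 0"
    using regular_nonzero(2,4)[OF assms, of 1] qpoch_self[of 1] by (auto simp: qpoch_Suc power2_eq_square)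
  have "1 - s * s * P / t = (t - s * s * P) / t" using nz by (simp add: diff_divide_distrib)
  moreover have "P * (1 - t / P) = P - t" "1 - s * (t * t) / t = 1 - s * t" "1 + s / t = (t + s) / t"
    using nz by (simp_all add: field_simps)
  moreover have "B_term s 1 0 = P * (1 - t / P) / (1 - s * s * P / t) * (1 - s * (t * t) / t) * (1 + s / t) / (1 - t * t)"
    by (simp add: B_term_def qpoch_Suc power2_eq_square flip: P_def)
  ultimately show b0: "B_term s 1 0 = (x * y - t) * (1 - s * t) * (t + s) / ((t - s * s * (x * y)) * (1 - t * t))"
    using nz by (simp add: mult_ac flip: P_def)
  have *: "inverse (t * t) * (t * t) = 1" "1 - inverse (t * t) = - (1 - t * t) / (t * t)"
    using nz by (simp_all add: field_simps)
  have "B_term s 1 1 = B_term s 1 0 * ((1 - s * s) * (1 - inverse (t * t)) * (t * t) / ((1 - t * t) * (1 + s) * (1 + s / t)))"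
    by (simp add: B_term_def qpoch_Suc power2_eq_square flip: P_def)
  also have "(1 - s * s) * (1 - inverse (t * t)) * (t * t) / ((1 - t * t) * (1 + s) * (1 + s / t)) = - (1 - s) * t / (t + s)"
  proof -
    have e: "1 - s * s = (1 - s) * (1 + s)" "1 + s / t = (t + s) / t"
      using nz by (simp_all add: field_simps)
    have ts: "t + s \<noteq> 0" using nz1(1) nz by (simp add: field_simps)
    have c: "a * m * (- d / e) * e / (d * m * (f / t)) = - a * t / f"
      if "m \<noteq> 0" "d \<noteq> 0" "e \<noteq> 0" "f \<noteq> 0" for a m d e f :: 'k
      using that nz by (simp add: field_simps)
    show ?thesis unfolding *(2) e by (rule c) (use nz nz1 ts in auto)
  qed
  also have "B_term s 1 0 * (- (1 - s) * t / (t + s)) = - ((x * y - t) * (1 - s * t) * (1 - s) * t) / ((t - s * s * (x * y)) * (1 - t * t))"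
  proof -
    have "t + s \<noteq> 0" using nz1(1) nz by (simp add: field_simps)
    then have c: "u * v * (t + s) / w * (- a * t / (t + s)) = - (u * v * a * t) / w" for u v w a :: 'k
      by simp
    show ?thesis unfolding b0 by (rule c)
  qed
  finally show "B_term s 1 1 = - ((x * y - t) * (1 - s * t) * (1 - s) * t) / ((t - s * s * (x * y)) * (1 - t * t))" .
qed

lemma B_term_rec_0:
  assumes s: "regular s"
  shows "B_term s (Suc j) 0 + B_term s j 0 - B_term (s / t) (Suc j) 0
    = F_outer s * ((1 + t / s) * (1 + t / (s * (x * y))) * B_term (s * t) j 0)"
proof (cases j)
  case 0
  define P where "P = x * y"
  define d1 d2 m where "d1 = t - s * s * P" and "d2 = t * t * t - s * s * P" and "m = 1 - t * t"
  have nz: "s \<noteq> 0" "P \<noteq> 0" "t \<noteq> 0"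
    using s x y t by (auto simp: regular_def P_def)
  have d: "d1 \<noteq> 0" "d2 \<noteq> 0" "m \<noteq> 0"
    using regular_nonzero(6,7)[OF s, of 1, folded P_def] qpoch_self[of 1] nz
    by (auto simp: qpoch_Suc d1_def d2_def m_def power2_eq_square power3_eq_cube)
  have 1: "B_term s 1 0 = (P - t) * (1 - s * t) * (t + s) / (d1 * m)"
    using B_term_1(1)[OF s] by (simp add: P_def d1_def m_def)
  have 2: "B_term (s / t) 1 0 = (P - t) * (1 - s) * (t * t + s) * t / (d2 * m)"
  proof -
    have "t - s / t * (s / t) * P = d2 / (t * t)" "t + s / t = (t * t + s) / t"
      using nz by (simp_all add: d2_def field_simps)
    then show ?thesis
      using B_term_1(1)[OF regular_divide[OF s], folded P_def m_def] nz by simp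
  qed
  have 3: "F_outer s = (s - 1) * (s * P - t * t) * (s * s * P) / (d1 * d2)"
  proof -
    have "(s * s * P - t) * (s * s * P - t * t * t) = d1 * d2" by (simp add: d1_def d2_def algebra_simps)
    then show ?thesis using F_outer_alt[OF s] by (simp add: P_def)
  qed
  have 4: "(1 + t / s) * (1 + t / (s * P)) = (s + t) * (s * P + t) / (s * s * P)"
    using nz by (simp add: field_simps)
  \<comment> \<open>The claim multiplied by the common denominator
    \<open>d1 * d2 * m\<close>.\<close>
  have "(P - t) * (1 - s * t) * (t + s) * d2 + d1 * d2 * m - (P - t) * (1 - s) * (t * t + s) * t * d1
      = (s - 1) * (s * P - t * t) * (s + t) * (s * P + t) * m"
    unfolding d1_def d2_def m_def by (simp add: algebra_simps)
  then have "((P - t) * (1 - s * t) * (t + s) * d2 + d1 * d2 * m - (P - t) * (1 - s) * (t * t + s) * t * d1) / (d1 * d2 * m)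
      = (s - 1) * (s * P - t * t) * (s + t) * (s * P + t) * m / (d1 * d2 * m)" by simp
  then have "B_term s 1 0 + 1 - B_term (s / t) 1 0 = F_outer s * ((1 + t / s) * (1 + t / (s * P)))"
    unfolding 1 2 3 4 using d nz by (simp add: add_divide_distrib diff_divide_distrib mult_ac)
  then show ?thesis using 0 by (simp add: B_term_def flip: P_def)
next
  case (Suc I)
  then show ?thesis using B_term_rec_core_0[OF s, of I] by simp
qed

lemma B_term_rec_Suc:
  assumes s: "regular s" and "k \<le> j"
  shows "B_term s (Suc j) (Suc k) + B_term s j (Suc k) - B_term (s / t) (Suc j) (Suc k)
    = F_outer s * ((1 + t / (s * (t^2) ^ Suc k)) * (1 + t * (t^2) ^ Suc k / (s * (x * y))) * B_term (s * t) j (Suc k)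
       - t / (s * (t^2) ^ k) * (1 - t * (t^2) ^ k / (x * y)) * B_term (s * t) j k)"
proof (cases j)
  case 0
  define P where "P = x * y"
  define d1 d2 m where "d1 = t - s * s * P" and "d2 = t * t * t - s * s * P" and "m = 1 - t * t"
  have nz: "s \<noteq> 0" "P \<noteq> 0" "t \<noteq> 0"
    using s x y t by (auto simp: regular_def P_def)
  have d: "d1 \<noteq> 0" "d2 \<noteq> 0" "m \<noteq> 0"
    using regular_nonzero(6,7)[OF s, of 1, folded P_def] qpoch_self[of 1] nz
    by (auto simp: qpoch_Suc d1_def d2_def m_def power2_eq_square power3_eq_cube)
  have 1: "B_term s 1 1 = - ((P - t) * (1 - s * t) * (1 - s) * t) / (d1 * m)"
    using B_term_1(2)[OF s] by (simp add: P_def d1_def m_def)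
  have 2: "B_term (s / t) 1 1 = - ((P - t) * (1 - s) * (t - s) * t * t) / (d2 * m)"
  proof -
    have "t - s / t * (s / t) * P = d2 / (t * t)" "1 - s / t = (t - s) / t"
      using nz by (simp_all add: d2_def field_simps)
    then show ?thesis
      using B_term_1(2)[OF regular_divide[OF s], folded P_def m_def] nz by simp
  qed
  have 3: "F_outer s = (s - 1) * (s * P - t * t) * (s * s * P) / (d1 * d2)"
  proof -
    have "(s * s * P - t) * (s * s * P - t * t * t) = d1 * d2" by (simp add: d1_def d2_def algebra_simps)
    then show ?thesis using F_outer_alt[OF s] by (simp add: P_def)
  qed
  have 4: "t / s * (1 - t / P) = t * (P - t) * s / (s * s * P)"
    using nz by (simp add: field_simps)
  have "- ((P - t) * (1 - s * t) * (1 - s) * t) * d2 - - ((P - t) * (1 - s) * (t - s) * t * t) * d1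
      = - ((s - 1) * (s * P - t * t) * (t * (P - t) * s) * m)"
    unfolding d1_def d2_def m_def by (simp add: algebra_simps)
  then have "(- ((P - t) * (1 - s * t) * (1 - s) * t) * d2 - - ((P - t) * (1 - s) * (t - s) * t * t) * d1) / (d1 * d2 * m)
      = - ((s - 1) * (s * P - t * t) * (t * (P - t) * s) * m) / (d1 * d2 * m)" by simp
  \<comment> \<open>With j = 0 also k = 0. The terms with indices 0 and 1 vanish, and
    \<open>B_term (s * t) 0 0\<close> is 1.\<close>
  then have "B_term s 1 1 - B_term (s / t) 1 1 = F_outer s * (- (t / s * (1 - t / P)))"
    unfolding 1 2 3 4 using d nz by (simp add: add_divide_distrib diff_divide_distrib mult_ac)
  then show ?thesis using 0 assms(2) by (simp add: B_term_def[of _ 0] flip: P_def)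
next
  case (Suc I)
  then show ?thesis using B_term_rec_core[OF s, of I k] by simp
qed

text \<open>The function f(s) = F(s,0), for x = a^2 and y = c^2.\<close>

definition F_base :: "'k \<Rightarrow> 'k" where
  "F_base s = F_outer s * (1 + t / (s * x)) * (1 + t / (s * y))"

text \<open>
  The factor \<open>(1 + t/(sx)) (1 + t/(sy))\<close> of \<open>F_base s\<close> is split, separately for each \<open>k\<close>, into a part
  \<open>E k\<close> depending on \<open>x y\<close> only and a multiple of \<open>R (k + 1) / R k\<close> (fact \<open>AE\<close> below); then both sides
  agree coefficient by coefficient in the \<open>R k\<close>.
\<close>

lemma B_red_rec:
  assumes s: "regular s"
  shows "B0 s (Suc j) + B0 s j = B0 (s / t) (Suc j) + F_base s * B0 (s * t) j"
proof -
  \<comment> \<open>With Q = t^(2k), the multiple t/(sQ) of (1 - Q/x)(1 - Q/y) is the one whose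
    addition to (1 + t/(sx))(1 + t/(sy)) cancels 1/x + 1/y, the only part not depending on xy alone.
    The sum factors as \<open>E k\<close>, and \<open>A k\<close> is t/(sQ) times the denominator of
    \<open>R (Suc k) / R k\<close>.\<close>
  define A where "A = (\<lambda>k. t / (s * (t^2) ^ k) * (1 - t * (t^2) ^ k / (x * y)))"
  define E where "E = (\<lambda>k. (1 + t / (s * (t^2) ^ k)) * (1 + t * (t^2) ^ k / (s * (x * y))))"
  define L where "L = (\<lambda>k. B_term s (Suc j) k + B_term s j k - B_term (s / t) (Suc j) k)"
  have L0: "L 0 = F_outer s * (E 0 * B_term (s * t) j 0)"
    using B_term_rec_0[OF s, of j] by (simp add: L_def E_def)
  have L1: "L (Suc k) = F_outer s * (E (Suc k) * B_term (s * t) j (Suc k) - A k * B_term (s * t) j k)" if "k \<le> j" for k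
    using B_term_rec_Suc[OF s that] by (simp add: L_def E_def A_def)
  have AE: "E k * R k - A k * R (Suc k) = (1 + t / (s * x)) * (1 + t / (s * y)) * R k" for k
  proof -
    define Q where "Q = (t^2) ^ k"
    have nz: "s \<noteq> 0" "Q \<noteq> 0" using s t by (auto simp: regular_def Q_def)
    have d: "1 - t * Q / (x * y) \<noteq> 0"
      using qpoch_t_div_xy_nonzero[of "Suc k"] by (auto simp: qpoch_Suc Q_def mult_ac)
    have "(1 - t * Q / (x * y)) * R (Suc k) = (1 - Q / x) * (1 - Q / y) * R k"
    proof -
      have e: "1 - Q * (t / (x * y)) = 1 - t * Q / (x * y)" by (simp add: mult_ac)
      have c: "D * (u * v * (u' * v') / (w * D)) = v * v' * (u * u' / w)" if "D \<noteq> 0" for D u v u' v' w :: 'k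
        using that by (simp add: mult_ac)
      show ?thesis
        using c[OF d] unfolding R_def qpoch_Suc Q_def[symmetric] e by simp
    qed
    then have "A k * R (Suc k) = t / (s * Q) * ((1 - Q / x) * (1 - Q / y)) * R k"
      by (simp add: A_def mult_ac flip: Q_def)
    moreover have "E k - t / (s * Q) * ((1 - Q / x) * (1 - Q / y)) = (1 + t / (s * x)) * (1 + t / (s * y))"
      unfolding E_def Q_def[symmetric] using nz x y by (simp add: field_simps)
    ultimately show ?thesis by (metis left_diff_distrib)
  qed
  have "B0 s (Suc j) + B0 s j - B0 (s / t) (Suc j) = (\<Sum>k\<le>Suc j. L k * R k)"
  proof -
    have "B0 s j = (\<Sum>k\<le>Suc j. B_term s j k * R k)"
      using B_red_eq_sum[OF s, of j] by (simp add: B_term_eq_0)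
    then show ?thesis
      unfolding B_red_eq_sum[OF s, of "Suc j"] B_red_eq_sum[OF regular_divide[OF s], of "Suc j"]
      by (simp only: L_def sum.distrib sum_subtractf left_diff_distrib distrib_right)
  qed
  also have "\<dots> = F_outer s * ((\<Sum>k\<le>Suc j. E k * B_term (s * t) j k * R k) - (\<Sum>k\<le>j. A k * B_term (s * t) j k * R (Suc k)))"
  proof -
    have "(\<Sum>k\<le>j. L (Suc k) * R (Suc k))
       = (\<Sum>k\<le>j. F_outer s * (E (Suc k) * B_term (s * t) j (Suc k) * R (Suc k)) - F_outer s * (A k * B_term (s * t) j k * R (Suc k)))"
      by (intro sum.cong refl) (simp add: L1 algebra_simps)
    then show ?thesis
      unfolding sum.atMost_Suc_shift L0 by (simp add: sum_subtractf sum_distrib_left algebra_simps)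
  qed
  also have "(\<Sum>k\<le>Suc j. E k * B_term (s * t) j k * R k) = (\<Sum>k\<le>j. E k * B_term (s * t) j k * R k)"
    by (simp add: B_term_eq_0)
  also have "\<dots> - (\<Sum>k\<le>j. A k * B_term (s * t) j k * R (Suc k)) = (\<Sum>k\<le>j. B_term (s * t) j k * (E k * R k - A k * R (Suc k)))"
    by (simp add: algebra_simps flip: sum_subtractf)
  also have "\<dots> = (1 + t / (s * x)) * (1 + t / (s * y)) * B0 (s * t) j"
    unfolding AE B_red_eq_sum[OF regular_mult[OF s], of j] by (simp add: sum_distrib_left mult_ac)
  finally show ?thesis by (simp only: F_base_def mult.assoc diff_eq_eq add.commute)
qed

end

section \<open>Evaluation of rational functions\<close>

text \<open>At a pole \<open>eval_rf\<close> is a division by zero with value 0, so it does not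
  respect sums and products. This relation also asserts the absence of a pole, through any
  representation with nonvanishing denominator, and is therefore preserved by the field
  operations.\<close>

definition rf_value :: "ratfun \<Rightarrow> complex \<Rightarrow> complex \<Rightarrow> bool" where
  "rf_value f x v \<longleftrightarrow> (\<exists>p q. f = to_fract p / to_fract q \<and> poly q x \<noteq> 0 \<and> v = poly p x / poly q x)"

lemma rf_value_eval: "rf_value f x v \<Longrightarrow> eval_rf f x = v"
  by (auto simp: rf_value_def eval_rf_divide)

lemma rf_value_poly: "rf_value (to_fract p) x (poly p x)"
  unfolding rf_value_def by (intro exI[of _ p] exI[of _ 1]) auto

lemma rf_value_const: "rf_value (const_rf z) x z"
  using rf_value_poly[of "[:z:]" x] by (simp add: const_rf_def)

lemma rf_value_var: "rf_value var_rf x x"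
  using rf_value_poly[of "[:0, 1:]" x] by (simp add: var_rf_def)

lemma rf_value_1: "rf_value 1 x 1"
  using rf_value_poly[of 1 x] by simp

lemma rf_value_add:
  assumes "rf_value f x v" "rf_value g x w"
  shows "rf_value (f + g) x (v + w)"
proof -
  from assms obtain p q p' q' where *: "f = to_fract p / to_fract q" "poly q x \<noteq> 0" "v = poly p x / poly q x"
    "g = to_fract p' / to_fract q'" "poly q' x \<noteq> 0" "w = poly p' x / poly q' x"
    unfolding rf_value_def by blast
  then have "q \<noteq> 0" "q' \<noteq> 0" by auto
  with * show ?thesis unfolding rf_value_def
    by (intro exI[of _ "p * q' + p' * q"] exI[of _ "q * q'"]) (auto simp: add_frac_eq)
qed

lemma rf_value_mult:
  assumes "rf_value f x v" "rf_value g x w"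
  shows "rf_value (f * g) x (v * w)"
proof -
  from assms obtain p q p' q' where *: "f = to_fract p / to_fract q" "poly q x \<noteq> 0" "v = poly p x / poly q x"
    "g = to_fract p' / to_fract q'" "poly q' x \<noteq> 0" "w = poly p' x / poly q' x"
    unfolding rf_value_def by blast
  then show ?thesis unfolding rf_value_def
    by (intro exI[of _ "p * p'"] exI[of _ "q * q'"]) auto
qed

lemma rf_value_minus: "rf_value f x v \<Longrightarrow> rf_value (- f) x (- v)"
  using rf_value_mult[OF rf_value_poly[of "- 1" x], of f v] by simp

lemma rf_value_diff: "rf_value f x v \<Longrightarrow> rf_value g x w \<Longrightarrow> rf_value (f - g) x (v - w)"
  using rf_value_add[OF _ rf_value_minus, of f x v g w] by simp

lemma rf_value_inverse:
  assumes "rf_value f x v" "v \<noteq> 0"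
  shows "rf_value (inverse f) x (inverse v)"
proof -
  from assms(1) obtain p q where *: "f = to_fract p / to_fract q" "poly q x \<noteq> 0" "v = poly p x / poly q x"
    unfolding rf_value_def by blast
  with assms(2) show ?thesis unfolding rf_value_def
    by (intro exI[of _ q] exI[of _ p]) auto
qed

lemma rf_value_divide: "rf_value f x v \<Longrightarrow> rf_value g x w \<Longrightarrow> w \<noteq> 0 \<Longrightarrow> rf_value (f / g) x (v / w)"
  unfolding divide_inverse by (intro rf_value_mult rf_value_inverse)

lemma rf_value_power: "rf_value f x v \<Longrightarrow> rf_value (f ^ n) x (v ^ n)"
  by (induction n) (auto intro: rf_value_1 rf_value_mult)

lemma rf_value_power_int: "rf_value f x v \<Longrightarrow> v \<noteq> 0 \<Longrightarrow> rf_value (f powi n) x (v powi n)"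
  by (simp add: power_int_def rf_value_power rf_value_inverse)

lemma rf_value_sum:
  "(\<And>k. k \<in> A \<Longrightarrow> rf_value (f k) x (v k)) \<Longrightarrow> rf_value (\<Sum>k\<in>A. f k) x (\<Sum>k\<in>A. v k)"
  using rf_value_poly[of 0 x] by (induction A rule: infinite_finite_induct) (auto intro: rf_value_add)

lemma rf_value_prod:
  "(\<And>k. k \<in> A \<Longrightarrow> rf_value (f k) x (v k)) \<Longrightarrow> rf_value (\<Prod>k\<in>A. f k) x (\<Prod>k\<in>A. v k)"
  by (induction A rule: infinite_finite_induct) (auto intro: rf_value_mult rf_value_1)

lemma rf_value_qpoch: "rf_value z x v \<Longrightarrow> rf_value q x w \<Longrightarrow> rf_value (qpoch z q n) x (qpoch v w n)"
  unfolding qpoch_def by (intro rf_value_prod rf_value_diff rf_value_mult rf_value_power rf_value_1)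

lemmas rf_value_intros = rf_value_const rf_value_var rf_value_1 rf_value_add rf_value_mult rf_value_minus
  rf_value_diff rf_value_inverse rf_value_divide rf_value_power rf_value_power_int rf_value_sum rf_value_qpoch

section \<open>The coefficients B and F at powers of t\<close>

lemma var_rf_power2_neq: "var_rf ^ 2 \<noteq> const_rf z"
  by (simp add: var_rf_def const_rf_def power2_eq_square flip: to_fract_mult)

lemma const_rf_mult: "const_rf (a * b) = const_rf a * const_rf b"
  by (simp add: const_rf_def flip: to_fract_mult)

lemma const_rf_power: "const_rf (a ^ n) = const_rf a ^ n"
proof -
  have "const_rf 1 = 1" by (simp add: const_rf_def flip: one_pCons)
  then show ?thesis by (induction n) (auto simp: const_rf_mult)
qed

lemma const_rf_eq_0_iff: "const_rf a = 0 \<longleftrightarrow> a = 0"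
  by (simp add: const_rf_def)

text \<open>Away from s^2 = t^2 the factor 1 - s^2/t^2 cancels against the first factor of
  (s^2/t^2;t^2)_j if j > 0, and against the equal numerator if j = 0. The indeterminate satisfies
  this condition even though the point of evaluation s = t does not.\<close>

lemma B_expr_eq_B_red:
  fixes a c t s :: "'k::field"
  assumes "s \<noteq> 0" "t \<noteq> 0" "s^2 \<noteq> t^2"
  shows "B_expr a c t s j = B_red (a^2) (c^2) t s j"
proof -
  have p1: "t powi (- 2) = 1 / t^2" by (simp add: power_int_minus divide_inverse)
  have p2: "t powi (2 * int j - 2) = (t^2) ^ j / t^2"
    using assms by (simp add: power_int_diff power_int_mult)
  have p3: "t powi (- 2 * int j) = inverse ((t^2) ^ j)"
    using assms by (simp add: power_int_minus power_int_mult)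
  have p4: "t powi (4 * int j - 2) = (t^2) ^ (2 * j) / t^2"
  proof -
    have "t powi (4 * int j) = t powi int (4 * j)" by simp
    also have "\<dots> = (t^2) ^ (2 * j)" unfolding power_int_of_nat by (simp flip: power_mult)
    finally show ?thesis using assms by (simp add: power_int_diff)
  qed
  have p5: "s powi (- int j) = inverse s ^ j"
    by (simp add: power_int_minus power_inverse)
  let ?g = "\<lambda>k. qpochs [- s * a^2, - s * c^2, s^2 * ((t^2) ^ j / t^2), inverse ((t^2) ^ j)] (t^2) k
      / qpochs [t^2, - s, - s * t, s^2 * a^2 * c^2 / t] (t^2) k * (t^2) ^ k"
  \<comment> \<open>The parameter t^(-2j) annihilates all terms beyond k = j; this finiteness is
    what gives \<open>Sum_any\<close> its intended value.\<close>
  have "Sum_any ?g = sum ?g {..j}"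
  proof (rule Sum_any.expand_superset)
    show "{k. ?g k \<noteq> 0} \<subseteq> {..j}"
    proof
      fix k assume "k \<in> {k. ?g k \<noteq> 0}"
      then have "qpoch (inverse ((t^2) ^ j)) (t^2) k \<noteq> 0" by (auto simp: qpochs_def)
      then show "k \<in> {..j}"
        using qpoch_inverse_power_eq_0[of "t^2" j k] assms by (metis atMost_iff not_le power_not_zero)
    qed
  qed auto
  then have phi: "phi43 (- s * a^2) (- s * c^2) (s^2 * t powi (2 * int j - 2)) (t powi (-2 * int j))
             (- s) (- s * t) (s^2 * a^2 * c^2 / t) (t^2) (t^2)
     = (\<Sum>k\<le>j. qpoch (inverse ((t^2) ^ j)) (t^2) k * qpoch (s^2 * (t^2) ^ j / t^2) (t^2) k
           * qpoch (- s * a^2) (t^2) k * qpoch (- s * c^2) (t^2) k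
           / (qpoch (t^2) (t^2) k * qpoch (- s) (t^2) k * qpoch (- s * t) (t^2) k
              * qpoch (s^2 * (a^2 * c^2) / t) (t^2) k) * (t^2) ^ k)"
    unfolding phi43_def p2 p3 by (simp add: qpochs_def mult_ac)
  show ?thesis
  proof (cases j)
    case 0
    have "1 - s^2 / t^2 \<noteq> 0" using assms by simp
    then show ?thesis unfolding B_expr_def phi p1 using 0
      by (simp add: B_red_def p1 divide_inverse power_int_minus)
  next
    case (Suc j')
    then have j: "j \<noteq> 0" by simp
    have d: "1 - s^2 / t^2 \<noteq> 0" using assms by simp
    have e: "qpoch (s^2 / t^2) (t^2) j = (1 - s^2 / t^2) * qpoch (s^2) (t^2) (j - 1)"
      using assms Suc by (simp add: qpoch_Suc_left)
    have c: "A * (D * Q / Z) * (u / D) * S = A * (Q / Z) * u * S" if "D \<noteq> 0" for A D Q Z u S :: 'k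
      using that by simp
    have s1: "s^2 * (1 / t^2) = s^2 / t^2" by simp
    show ?thesis
      unfolding B_expr_def phi p1 p4 p5 B_red_def if_not_P[OF j] e s1
      unfolding times_divide_eq_right[of "s^2"] by (rule c[OF d])
  qed
qed

lemma generic_squares: "generic_params a c t \<Longrightarrow> generic (a^2) (c^2) t"
  unfolding generic_params_def by unfold_locales auto

lemma power_int_double:
  fixes t :: "'k::field"
  shows "t \<noteq> 0 \<Longrightarrow> t powi (2 * k) = (t powi k)^2"
  by (simp only: mult_2 power2_eq_square power_int_add simp_thms)

text \<open>If t^(m+n) = -1, squaring makes t a root of unity unless m + n = 0, and t^0 = 1 differs
  from -1 over the complex numbers. In the second condition dividing by t^(2m) preserves the parity
  of the exponent.\<close>

lemma regular_power_int:
  assumes "generic x y (t::complex)"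
  shows "generic.regular x y t (t powi m)"
proof -
  interpret generic x y t by fact
  have "t powi m * t powi n \<noteq> - 1" for n
  proof
    assume "t powi m * t powi n = - 1"
    then have *: "t powi (m + n) = - 1" using t by (simp add: power_int_add)
    then have "(t powi (m + n))^2 = 1" by simp
    then have "t powi (2 * (m + n)) = 1"
      by (subst power_int_double[OF t])
    then have "t ^ nat \<bar>2 * (m + n)\<bar> = 1"
      by (cases "2 * (m + n) \<ge> 0") (auto simp: power_int_def abs_if power_inverse)
    then have "nat \<bar>2 * (m + n)\<bar> = 0" using t_power by blast
    then have "m + n = 0" by simp
    with * show False by simp
  qed
  moreover have "(t powi m)^2 * (x * y) \<noteq> t powi n" if "odd n" for n
  proof
    assume *: "(t powi m)^2 * (x * y) = t powi n"
    have "x * y = t powi n / (t powi m)^2" using t by (simp flip: *)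
    also have "\<dots> = t powi (n - 2 * m)"
      using t by (simp add: power_int_diff power_int_double)
    finally show False using xy_power[of "n - 2 * m"] that by simp
  qed
  ultimately show ?thesis using t by (simp add: regular_def)
qed

lemma eval_B_coeff:
  assumes "generic_params a c t"
  shows "eval_rf (B_coeff a c t j) (t ^ n) = B_red (a^2) (c^2) t (t ^ n) j"
proof (rule rf_value_eval)
  interpret generic "a^2" "c^2" t by (rule generic_squares[OF assms])
  have s: "regular (t ^ n)" using regular_power_int[OF generic_axioms, of "int n"] by simp
  \<comment> \<open>The cancellation takes place in the field of rational functions, before
    evaluation, so the point s = t is covered.\<close>
  have "B_coeff a c t j = B_red (const_rf a ^ 2) (const_rf c ^ 2) (const_rf t) var_rf j"
    unfolding B_coeff_def
  proof (rule B_expr_eq_B_red)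
    show "const_rf t \<noteq> 0" using t by (simp add: const_rf_eq_0_iff)
    show "var_rf \<noteq> 0" by (simp add: var_rf_def)
    show "var_rf ^ 2 \<noteq> const_rf t ^ 2" using var_rf_power2_neq[of "t^2"] by (simp add: const_rf_power)
  qed
  also have "rf_value \<dots> (t ^ n) (B_red (a^2) (c^2) t (t ^ n) j)"
  proof (cases "j = 0")
    case True
    then show ?thesis by (simp add: B_red_def rf_value_1)
  next
    case False
    then show ?thesis unfolding B_red_def if_not_P[OF False]
      by (intro rf_value_intros) (use t qpoch_self regular_nonzero[OF s] in auto)
  qed
  finally show "rf_value (B_coeff a c t j) (t ^ n) (B_red (a^2) (c^2) t (t ^ n) j)" .
qed

lemma eval_F_coeff:
  assumes "generic_params a c t"
  shows "eval_rf (F_coeff a c t l) (t ^ n) = generic.F_base (a^2) (c^2) t (t powi (int n - l))"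
proof (rule rf_value_eval)
  interpret generic "a^2" "c^2" t by (rule generic_squares[OF assms])
  define w where "w = t powi (int n - l)"
  have w: "regular w" unfolding w_def by (rule regular_power_int[OF generic_axioms])
  have nz: "w \<noteq> 0" "t powi l \<noteq> 0" "a \<noteq> 0" "c \<noteq> 0" using t x y by (auto simp: w_def)
  have tn: "t ^ n = w * t powi l" using t by (simp add: w_def flip: power_int_add)
  have e: "t powi l / t ^ n = 1 / w" "t powi (l + 2) / (t ^ n * a^2 * c^2) = t^2 / (w * (a^2 * c^2))"
    "t powi (l + 1) / (t ^ n * a^2) = t / (w * a^2)" "t powi (l + 1) / (t ^ n * c^2) = t / (w * c^2)"
    "t powi (2 * l + 1) / ((t ^ n)^2 * a^2 * c^2) = t / (w^2 * (a^2 * c^2))"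
    "t powi (2 * l + 3) / ((t ^ n)^2 * a^2 * c^2) = t^3 / (w^2 * (a^2 * c^2))"
    unfolding tn using nz t
    by (simp_all add: power_int_add power_int_mult mult.commute[of 2] power_mult_distrib)
  have d: "1 - t / (w^2 * (a^2 * c^2)) \<noteq> 0" "1 - t^3 / (w^2 * (a^2 * c^2)) \<noteq> 0"
    using regular_nonzero(6,7)[OF w, of 1] t nz by (auto simp: qpoch_Suc)
  have "F_expr a c t (t ^ n) l = F_base w"
    unfolding F_expr_def e F_base_def F_outer_def by simp
  moreover have "rf_value (F_coeff a c t l) (t ^ n) (F_expr a c t (t ^ n) l)"
    unfolding F_coeff_def F_expr_def
    by (intro rf_value_intros) (use t nz d[folded e(5,6)] in auto)
  ultimately show "rf_value (F_coeff a c t l) (t ^ n) (F_base w)" by simp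
qed

section \<open>The recurrence for C and the sum over paths\<close>

lemma B_red_0: "B_red x y t s 0 = 1"
  by (simp add: B_red_def)

text \<open>
  \<open>C(s,j)\<close> at \<open>s = t\<^sup>n\<close>, that is, for \<open>m = n - 1\<close>. The value \<open>n = 0\<close> starts the recurrence.
\<close>

definition C_red :: "complex \<Rightarrow> complex \<Rightarrow> complex \<Rightarrow> nat \<Rightarrow> nat \<Rightarrow> complex" where
  "C_red x y t n j = (\<Sum>i\<le>j. B_red x y t (t ^ n) i * ((of_nat n - 1 + 2 * of_nat j) gchoose (j - i)))"

lemma C_coeff_eq_C_red:
  assumes "generic_params a c t"
  shows "C_coeff a c t (t ^ (r + 1)) (of_nat r) j = C_red (a^2) (c^2) t (Suc r) j"
  unfolding C_coeff_def C_red_def using eval_B_coeff[OF assms, of _ "r + 1"] by simp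

lemma C_red_rec:
  assumes "generic x y t"
  shows "C_red x y t (Suc n) (Suc j) = C_red x y t n (Suc j) + generic.F_base x y t (t ^ Suc n) * C_red x y t (Suc (Suc n)) j"
proof -
  interpret generic x y t by fact
  define N where "N = (of_nat n + 1 + 2 * of_nat j :: complex)"
  have s: "regular (t ^ Suc n)" using regular_power_int[OF assms, of "int (Suc n)"] by (simp only: power_int_of_nat)
  let ?g = "F_base (t ^ Suc n)"
  have rec: "B0 (t ^ Suc n) (Suc i) + B0 (t ^ Suc n) i = B0 (t ^ n) (Suc i) + ?g * B0 (t ^ Suc (Suc n)) i" for i
    using B_red_rec[OF s, of i] t by (simp add: mult_ac)
  \<comment> \<open>The upper binomial argument m + 2j is N + 1 on the left of the recurrence and N
    in both terms on the right: raising s by two powers of t makes up for lowering j by one.\<close>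
  have N: "of_nat (Suc n) - 1 + 2 * of_nat (Suc j) = N + 1" "of_nat n - 1 + 2 * of_nat (Suc j) = N"
    "of_nat (Suc (Suc n)) - 1 + 2 * of_nat j = N"
    by (simp_all add: N_def)
  have pascal: "(N + 1) gchoose (Suc j - i) = (N gchoose (j - i)) + (N gchoose (Suc j - i))" if "i \<le> j" for i
    using that by (simp add: Suc_diff_le gbinomial_Suc_Suc)
  have "C_red x y t (Suc n) (Suc j) = (\<Sum>i\<le>j. B0 (t ^ Suc n) i * ((N + 1) gchoose (Suc j - i))) + B0 (t ^ Suc n) (Suc j)"
    unfolding C_red_def N by simp
  also have "(\<Sum>i\<le>j. B0 (t ^ Suc n) i * ((N + 1) gchoose (Suc j - i)))
      = (\<Sum>i\<le>j. B0 (t ^ Suc n) i * (N gchoose (j - i))) + (\<Sum>i\<le>j. B0 (t ^ Suc n) i * (N gchoose (Suc j - i)))"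
    by (simp add: pascal distrib_left sum.distrib)
  also have "(\<Sum>i\<le>j. B0 (t ^ Suc n) i * (N gchoose (j - i))) + (\<Sum>i\<le>j. B0 (t ^ Suc n) i * (N gchoose (Suc j - i))) + B0 (t ^ Suc n) (Suc j)
    = (\<Sum>i\<le>j. B0 (t ^ Suc n) i * (N gchoose (j - i))) + (\<Sum>i\<le>Suc j. B0 (t ^ Suc n) i * (N gchoose (Suc j - i)))"
    by simp
  \<comment> \<open>Shifting the index in the second sum pairs B(s,i+1) with B(s,i) under the same
    binomial; the term i = 0 is split off.\<close>
  also have "\<dots> = (N gchoose Suc j) + (\<Sum>i\<le>j. (B0 (t ^ Suc n) (Suc i) + B0 (t ^ Suc n) i) * (N gchoose (j - i)))"
    unfolding sum.atMost_Suc_shift by (simp add: B_red_0 distrib_right sum.distrib)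
  also have "\<dots> = (N gchoose Suc j) + (\<Sum>i\<le>j. B0 (t ^ n) (Suc i) * (N gchoose (j - i))) + ?g * (\<Sum>i\<le>j. B0 (t ^ Suc (Suc n)) i * (N gchoose (j - i)))"
    unfolding rec by (simp only: distrib_right sum.distrib sum_distrib_left mult.assoc add.assoc)
  also have "(N gchoose Suc j) + (\<Sum>i\<le>j. B0 (t ^ n) (Suc i) * (N gchoose (j - i))) = C_red x y t n (Suc j)"
    unfolding C_red_def N sum.atMost_Suc_shift by (simp add: B_red_0)
  also have "(\<Sum>i\<le>j. B0 (t ^ Suc (Suc n)) i * (N gchoose (j - i))) = C_red x y t (Suc (Suc n)) j"
    unfolding C_red_def N by simp
  finally show ?thesis .
qed

lemma C_red_0: "C_red x y t n 0 = 1"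
  by (simp add: C_red_def B_red_0)

lemma C_red_at_1:
  assumes "generic x y t"
  shows "C_red x y t 0 (Suc j) = 0"
proof -
  interpret generic x y t by fact
  have nz: "t \<noteq> 0" "1 - t^2 \<noteq> 0" using t t_power[of 2] by auto
  have b1: "B0 1 (Suc 0) = - 1"
    using nz by (simp add: B_red_def qpoch_Suc power2_eq_square)
  \<comment> \<open>For j > 1 the factorial (s^2;t^2)_(j-1) contains the factor 1 - s^2, which
    vanishes at s = 1.\<close>
  have b2: "B0 1 (Suc (Suc i)) = 0" for i
    by (simp add: B_red_def qpoch_Suc_left)
  define N where "N = (2 * of_nat j + 1 :: complex)"
  have "C_red x y t 0 (Suc j) = (\<Sum>i\<le>Suc j. B0 1 i * (N gchoose (Suc j - i)))"
    by (simp add: C_red_def N_def add.commute)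
  also have "\<dots> = (N gchoose Suc j) - (N gchoose j)"
  proof (cases j)
    case 0
    then show ?thesis by (simp add: B_red_0 b1)
  next
    case (Suc i)
    show ?thesis unfolding Suc sum.atMost_Suc_shift[of _ "Suc i"] sum.atMost_Suc_shift[of _ i]
      by (simp add: B_red_0 b1 b2)
  qed
  \<comment> \<open>Here m = -1, so the upper argument is 2j + 1 and the two binomials agree by
    symmetry.\<close>
  also have "\<dots> = 0"
  proof -
    have "N = of_nat (2 * j + 1)" by (simp add: N_def)
    moreover have "(2 * j + 1) choose Suc j = (2 * j + 1) choose j"
      using binomial_symmetric[of "Suc j" "2 * j + 1"] by simp
    ultimately show ?thesis by (metis binomial_gbinomial diff_self)
  qed
  finally show ?thesis .
qed

text \<open>Telescoping the recurrence down to s = 1, where the initial value vanishes.\<close>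

lemma C_red_Suc:
  assumes "generic x y t"
  shows "C_red x y t (Suc r) (Suc j) = (\<Sum>n\<le>r. generic.F_base x y t (t ^ Suc n) * C_red x y t (Suc (Suc n)) j)"
  by (induction r) (use C_red_rec[OF assms] C_red_at_1[OF assms] in simp_all)

section \<open>Path sums\<close>

text \<open>With \<open>\<phi>\<close> n = f(t^n) the factor F(t^(r+1), d) is \<open>\<phi>\<close>
  at r + 1 - d. The combinatorics uses nothing else about F.\<close>

definition path_sum :: "(int \<Rightarrow> complex) \<Rightarrow> nat \<Rightarrow> nat \<Rightarrow> complex" where
  "path_sum \<phi> r i = (\<Sum>d\<in>path_set r i. \<Prod>k<i. \<phi> (int r + 1 - d ! k))"

lemma sum_int_reverse: "(\<Sum>d\<in>{0..int r}. g (int r - d)) = (\<Sum>n\<le>r. g (int n))"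
  by (rule sum.reindex_bij_witness[of _ "\<lambda>n. int r - int n" "\<lambda>d. nat (int r - d)"]) auto

lemma path_sum_1: "path_sum \<phi> r (Suc 0) = (\<Sum>n\<le>r. \<phi> (int n + 1))"
proof -
  have "path_set r (Suc 0) = (\<lambda>d. [d]) ` {0..int r}"
    by (auto simp: path_set_def length_Suc_conv)
  then have "path_sum \<phi> r (Suc 0) = (\<Sum>d\<in>{0..int r}. \<phi> (int r + 1 - d))"
    by (simp add: path_sum_def sum.reindex inj_on_def)
  also have "\<dots> = (\<Sum>n\<le>r. \<phi> (int n + 1))"
    using sum_int_reverse[of "\<lambda>n. \<phi> (n + 1)" r] by (simp add: algebra_simps)
  finally show ?thesis .
qed

text \<open>
  After the first entry \<open>x\<close> a path is constrained only by \<open>x - 1\<close>, so shifting the rest by \<open>x - 1\<close> gives a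
  path with \<open>r\<close> replaced by \<open>r - x + 1\<close>.
\<close>

lemma path_set_Cons:
  "x # d \<in> path_set r (Suc (Suc i)) \<longleftrightarrow>
     0 \<le> x \<and> x \<le> int r \<and> map (\<lambda>z. z - x + 1) d \<in> path_set (nat (int r - x) + 1) (Suc i)"
proof (cases "0 \<le> x \<and> x \<le> int r \<and> length d = Suc i")
  case True
  have *: "(\<forall>k. Suc k < Suc (Suc i) \<longrightarrow> (x # d) ! k - 1 \<le> (x # d) ! Suc k \<and> (x # d) ! Suc k \<le> int r)
    \<longleftrightarrow> x - 1 \<le> d ! 0 \<and> d ! 0 \<le> int r \<and> (\<forall>k. Suc k < Suc i \<longrightarrow> d ! k - 1 \<le> d ! Suc k \<and> d ! Suc k \<le> int r)"
    (is "(\<forall>k. ?P k) \<longleftrightarrow> ?Q")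
  proof -
    have "(\<forall>k. ?P k) \<longleftrightarrow> ?P 0 \<and> (\<forall>k. ?P (Suc k))" by (metis not0_implies_Suc)
    then show ?thesis by simp
  qed
  show ?thesis unfolding path_set_def mem_Collect_eq * using True by auto
next
  case False
  then show ?thesis by (auto simp: path_set_def)
qed

text \<open>The shift by x - 1 and the change from r to r - x + 1 leave the arguments of
  \<open>\<phi>\<close> unchanged: (r - x + 1) + 1 - (z - x + 1) = r + 1 - z. The rest of a path
  thus contributes a path sum for the same \<open>\<phi>\<close>, and the outer index is n = r - x
  for the first entry x.\<close>

lemma path_sum_Suc:
  "path_sum \<phi> r (Suc (Suc i)) = (\<Sum>n\<le>r. \<phi> (int n + 1) * path_sum \<phi> (Suc n) (Suc i))"
proof -
  let ?p = "\<lambda>x e. \<phi> (int r + 1 - x) * (\<Prod>k<Suc i. \<phi> (int (nat (int r - x) + 1) + 1 - e ! k))"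
  have "path_sum \<phi> r (Suc (Suc i))
     = (\<Sum>(x, e)\<in>(SIGMA x:{0..int r}. path_set (nat (int r - x) + 1) (Suc i)). ?p x e)"
    unfolding path_sum_def
  proof (rule sum.reindex_bij_witness[of _ "\<lambda>(x, e). x # map (\<lambda>z. z + x - 1) e"
        "\<lambda>d. (hd d, map (\<lambda>z. z - hd d + 1) (tl d))"])
    fix d assume d: "d \<in> path_set r (Suc (Suc i))"
    then obtain x e where xe: "d = x # e" by (cases d) (auto simp: path_set_def)
    have len: "length e = Suc i" using d by (simp add: xe path_set_def)
    have m: "0 \<le> x" "x \<le> int r" "map (\<lambda>z. z - x + 1) e \<in> path_set (nat (int r - x) + 1) (Suc i)"
      using d path_set_Cons by (auto simp: xe)
    show "(case (hd d, map (\<lambda>z. z - hd d + 1) (tl d)) of (x, e) \<Rightarrow> x # map (\<lambda>z. z + x - 1) e) = d"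
      by (simp add: xe o_def)
    show "(hd d, map (\<lambda>z. z - hd d + 1) (tl d)) \<in> (SIGMA x:{0..int r}. path_set (nat (int r - x) + 1) (Suc i))"
      using m by (simp add: xe)
    have "(\<Prod>k<Suc i. \<phi> (int (nat (int r - x) + 1) + 1 - map (\<lambda>z. z - x + 1) e ! k)) = (\<Prod>k<Suc i. \<phi> (int r + 1 - e ! k))"
      using m len by (intro prod.cong refl) (auto simp: algebra_simps)
    then show "(case (hd d, map (\<lambda>z. z - hd d + 1) (tl d)) of (x, e) \<Rightarrow> ?p x e) = (\<Prod>k<Suc (Suc i). \<phi> (int r + 1 - d ! k))"
      unfolding prod.lessThan_Suc_shift[of _ "Suc i"] by (simp add: xe)
  next
    fix p assume p: "p \<in> (SIGMA x:{0..int r}. path_set (nat (int r - x) + 1) (Suc i))"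
    obtain x e where xe: "p = (x, e)" by fastforce
    have m: "0 \<le> x" "x \<le> int r" "e \<in> path_set (nat (int r - x) + 1) (Suc i)" using p by (auto simp: xe)
    show "(hd (case p of (x, e) \<Rightarrow> x # map (\<lambda>z. z + x - 1) e),
        map (\<lambda>z. z - hd (case p of (x, e) \<Rightarrow> x # map (\<lambda>z. z + x - 1) e) + 1) (tl (case p of (x, e) \<Rightarrow> x # map (\<lambda>z. z + x - 1) e))) = p"
      by (simp add: xe o_def)
    show "(case p of (x, e) \<Rightarrow> x # map (\<lambda>z. z + x - 1) e) \<in> path_set r (Suc (Suc i))"
      using m by (simp add: xe path_set_Cons o_def)
  qed
  also have "\<dots> = (\<Sum>x\<in>{0..int r}. \<Sum>e\<in>path_set (nat (int r - x) + 1) (Suc i). ?p x e)"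
    by (rule sum.Sigma[symmetric]) (auto intro: finite_path_set)
  also have "\<dots> = (\<Sum>x\<in>{0..int r}. \<phi> (int r - x + 1) * path_sum \<phi> (nat (int r - x) + 1) (Suc i))"
    by (simp only: path_sum_def sum_distrib_left) (simp add: algebra_simps)
  also have "\<dots> = (\<Sum>n\<le>r. \<phi> (int n + 1) * path_sum \<phi> (Suc n) (Suc i))"
    using sum_int_reverse[of "\<lambda>n. \<phi> (n + 1) * path_sum \<phi> (nat n + 1) (Suc i)" r] by simp
  finally show ?thesis .
qed

text \<open>Lengthening the path by one entry calls the shorter case at all values n + 1 with n at
  most r, hence also at r + 1. The induction on i therefore leaves r arbitrary.\<close>

lemma C_red_eq_path_sum:
  assumes "generic x y t"
  shows "C_red x y t (Suc r) (Suc i) = path_sum (\<lambda>n. generic.F_base x y t (t powi n)) r (Suc i)"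
proof (induction i arbitrary: r)
  case 0
  have "t powi (int n + 1) = t ^ Suc n" for n
    using power_int_of_nat[of t "Suc n"] by (simp add: add.commute)
  then show ?case by (simp add: path_sum_1 C_red_Suc[OF assms] C_red_0)
next
  case (Suc i)
  have "t powi (int n + 1) = t ^ Suc n" for n
    using power_int_of_nat[of t "Suc n"] by (simp add: add.commute)
  then show ?case by (simp add: path_sum_Suc C_red_Suc[OF assms, of r "Suc i"] Suc.IH)
qed

theorem theorem7p3:
  fixes a c t :: complex and r :: nat
  assumes "generic_params a c t"
  shows "C_coeff a c t (t ^ (r + 1)) (of_nat r) 0 = 1 \<and>
         (\<forall>i>0. C_coeff a c t (t ^ (r + 1)) (of_nat r) i =
             (\<Sum>d\<in>path_set r i. \<Prod>k<i. eval_rf (F_coeff a c t (d ! k)) (t ^ (r + 1))))"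
proof (intro conjI allI impI)
  show "C_coeff a c t (t ^ (r + 1)) (of_nat r) 0 = 1"
    unfolding C_coeff_eq_C_red[OF assms] by (rule C_red_0)
  fix i :: nat assume "i > 0"
  then obtain j where i: "i = Suc j" by (cases i) auto
  show "C_coeff a c t (t ^ (r + 1)) (of_nat r) i =
             (\<Sum>d\<in>path_set r i. \<Prod>k<i. eval_rf (F_coeff a c t (d ! k)) (t ^ (r + 1)))"
    unfolding C_coeff_eq_C_red[OF assms] eval_F_coeff[OF assms] i
      C_red_eq_path_sum[OF generic_squares[OF assms]] path_sum_def
    by (simp add: add.commute)
qed

end
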